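(* Let $d\geq 3$ and $n\geq 1$ be integers, and for a line $\ell\subset\mathbb{P}^n$ let $H_\ell=\{[F]\in\mathbb{P}(\mathrm{Sym}^d\mathbb{C}^{n+1})^* : V(F)\text{ is tangent to the line }\ell\}$. Then $$\bigcap_{\ell\subset\mathbb{P}^n}H_\ell=\mathcal{S}_{d,1},$$ where the intersection runs over all lines $\ell\subset\mathbb{P}^n$.
   Context: Points of $\mathbb{P}(\mathrm{Sym}^d\mathbb{C}^{n+1})^*$ are classes $[F]$ of nonzero homogeneous polynomials $F\in\mathbb{C}[x_0,\dots,x_n]$ of degree $d$ (identified with symmetric tensors). The symmetric geometric rank is $\mathrm{sgr}(F)=\mathrm{codim}_{\mathbb{P}^n}\{[x]\in\mathbb{P}^n:\frac{\partial F}{\partial x_i}(x)=0,\ i=0,\dots,n\}$ (the empty set having codimension $n+1$), and $\mathcal{S}_{d,1}=\{[F] : \mathrm{sgr}(F)\leq 1\}$. $V(F)\subset\mathbb{P}^n$ is the (possibly non-reduced) hypersurface defined by $F$. $V(F)$ is tangent to a line $\ell$ if either $\ell\subset V(F)$ or the restriction $F|_\ell$ has a zero of multiplicity at least two; equivalently, $F|_\ell$ vanishes at some point of $\ell$ together with its first-order derivatives along $\ell$. *)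

theory Defs
  imports "HOL-Analysis.Analysis" "HOL-Computational_Algebra.Computational_Algebra"
    "HOL-Library.Poly_Mapping" "HOL-Library.Extended_Nat"
begin

section \<open>Polynomials in several variables\<close>

text \<open>
  A polynomial maps finitely supported exponent vectors to coefficients. Its variables are
  indexed by all natural numbers; the ring in \<open>x\<^sub>0, \<dots>, x\<^sub>n\<close> is cut out by a condition on the
  exponents.
\<close>

type_synonym cpoly = "(nat \<Rightarrow>\<^sub>0 nat) \<Rightarrow>\<^sub>0 complex"
type_synonym cvec = "nat \<Rightarrow>\<^sub>0 complex"

text \<open>The homogeneous polynomials of degree \<open>d\<close> in \<open>x\<^sub>0, \<dots>, x\<^sub>n\<close>, including \<open>0\<close>.\<close>

definition forms :: "nat \<Rightarrow> nat \<Rightarrow> cpoly set" where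
  "forms n d = {F. \<forall>m \<in> Poly_Mapping.keys F. Poly_Mapping.keys m \<subseteq> {..n} \<and>
      (\<Sum>i \<in> Poly_Mapping.keys m. Poly_Mapping.lookup m i) = d}"

text \<open>
  The value of a polynomial at a point \<open>x\<close> with coordinates in a commutative ring into which the
  coefficients are mapped by \<open>\<phi>\<close>.
\<close>

definition mp_eval :: "(complex \<Rightarrow> 'b) \<Rightarrow> (nat \<Rightarrow> 'b) \<Rightarrow> cpoly \<Rightarrow> 'b::comm_semiring_1" where
  "mp_eval \<phi> x F = (\<Sum>m \<in> Poly_Mapping.keys F.
      \<phi> (Poly_Mapping.lookup F m) * (\<Prod>i \<in> Poly_Mapping.keys m. x i ^ Poly_Mapping.lookup m i))"

definition val :: "cpoly \<Rightarrow> cvec \<Rightarrow> complex" where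
  "val F x = mp_eval (\<lambda>c. c) (Poly_Mapping.lookup x) F"

text \<open>
  The formal partial derivative. For exponents \<open>m\<close> with \<open>m\<^sub>i = 0\<close> the subtraction truncates, but
  then the coefficient is \<open>0\<close>.
\<close>

definition mp_deriv :: "nat \<Rightarrow> cpoly \<Rightarrow> cpoly" where
  "mp_deriv i F = (\<Sum>m \<in> Poly_Mapping.keys F.
      Poly_Mapping.single (m - Poly_Mapping.single i 1)
        (of_nat (Poly_Mapping.lookup m i) * Poly_Mapping.lookup F m))"


section \<open>Projective spaces\<close>

text \<open>
  Both \<open>\<complex>\<^sup>n\<^sup>+\<^sup>1\<close> and the space of forms consist of finitely supported functions, so
  one definition of homogeneous class serves both: \<open>[v]\<close> is the set of nonzero multiples of \<open>v\<close>.
\<close>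

definition scale :: "complex \<Rightarrow> ('k \<Rightarrow>\<^sub>0 complex) \<Rightarrow> ('k \<Rightarrow>\<^sub>0 complex)" where
  "scale c v = Poly_Mapping.map ((*) c) v"

definition proj_class :: "('k \<Rightarrow>\<^sub>0 complex) \<Rightarrow> ('k \<Rightarrow>\<^sub>0 complex) set" where
  "proj_class v = {scale c v | c. c \<noteq> 0}"

definition projectivization :: "('k \<Rightarrow>\<^sub>0 complex) set \<Rightarrow> ('k \<Rightarrow>\<^sub>0 complex) set set" where
  "projectivization V = proj_class ` (V - {0})"

definition vecs :: "nat \<Rightarrow> cvec set" where
  "vecs n = {v. Poly_Mapping.keys v \<subseteq> {..n}}"

definition proj_space :: "nat \<Rightarrow> cvec set set" where
  "proj_space n = projectivization (vecs n)"

definition line_through :: "cvec \<Rightarrow> cvec \<Rightarrow> cvec set set" where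
  "line_through u v = projectivization {scale s u + scale t v | s t. True}"

definition lines :: "nat \<Rightarrow> cvec set set set" where
  "lines n = {line_through u v | u v. u \<in> vecs n - {0} \<and> v \<in> vecs n - {0} \<and>
      proj_class u \<noteq> proj_class v}"


section \<open>The Zariski topology\<close>

definition proj_zeros :: "nat \<Rightarrow> cpoly set \<Rightarrow> cvec set set" where
  "proj_zeros n S = {p \<in> proj_space n. \<forall>f \<in> S. \<forall>x \<in> p. val f x = 0}"

definition zariski :: "nat \<Rightarrow> cvec set topology" where
  "zariski n = topology (\<lambda>U. \<exists>S \<subseteq> (\<Union>e. forms n e). U = proj_space n - proj_zeros n S)"

lemma poly_mapping_sum_single:
  "(\<Sum>m \<in> Poly_Mapping.keys F. Poly_Mapping.single m (Poly_Mapping.lookup F m)) = F"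
  by (rule poly_mapping_eqI)
     (auto simp: lookup_sum lookup_single when_def in_keys_iff sum.delta)

lemma val_superset:
  assumes "finite A" "Poly_Mapping.keys F \<subseteq> A"
  shows "val F x = (\<Sum>m \<in> A. Poly_Mapping.lookup F m *
    (\<Prod>i \<in> Poly_Mapping.keys m. Poly_Mapping.lookup x i ^ Poly_Mapping.lookup m i))"
  unfolding val_def mp_eval_def
  by (rule sum.mono_neutral_left) (use assms in \<open>auto simp: in_keys_iff\<close>)

lemma val_add: "val (F + G) x = val F x + val G x"
proof -
  let ?A = "Poly_Mapping.keys F \<union> Poly_Mapping.keys G"
  have "Poly_Mapping.keys (F + G) \<subseteq> ?A" by (rule keys_add)
  then show ?thesis
    by (simp add: val_superset[of ?A] lookup_add algebra_simps sum.distrib)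
qed

lemma val_zero: "val 0 x = 0"
  by (simp add: val_def mp_eval_def)

lemma val_sum: "val (sum f A) x = (\<Sum>a \<in> A. val (f a) x)"
  by (induction A rule: infinite_finite_induct) (auto simp: val_add val_zero)

lemma val_single:
  "val (Poly_Mapping.single m c) x =
     c * (\<Prod>i \<in> Poly_Mapping.keys m. Poly_Mapping.lookup x i ^ Poly_Mapping.lookup m i)"
  by (simp add: val_superset[of "{m}"])

lemma monomial_superset:
  fixes y :: "nat \<Rightarrow> complex"
  assumes "finite A" "Poly_Mapping.keys m \<subseteq> A"
  shows "(\<Prod>i \<in> Poly_Mapping.keys m. y i ^ Poly_Mapping.lookup m i) =
    (\<Prod>i \<in> A. y i ^ Poly_Mapping.lookup m i)"
  by (rule prod.mono_neutral_left) (use assms in \<open>auto simp: in_keys_iff\<close>)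

lemma monomial_add:
  fixes y :: "nat \<Rightarrow> complex"
  shows "(\<Prod>i \<in> Poly_Mapping.keys (m + m'). y i ^ Poly_Mapping.lookup (m + m') i) =
    (\<Prod>i \<in> Poly_Mapping.keys m. y i ^ Poly_Mapping.lookup m i) *
    (\<Prod>i \<in> Poly_Mapping.keys m'. y i ^ Poly_Mapping.lookup m' i)"
proof -
  let ?A = "Poly_Mapping.keys m \<union> Poly_Mapping.keys m'"
  have "(\<Prod>i \<in> Poly_Mapping.keys (m + m'). y i ^ Poly_Mapping.lookup (m + m') i) =
      (\<Prod>i \<in> ?A. y i ^ Poly_Mapping.lookup (m + m') i)"
    by (rule monomial_superset) (simp_all add: keys_add)
  also have "\<dots> = (\<Prod>i \<in> ?A. y i ^ Poly_Mapping.lookup m i) *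
      (\<Prod>i \<in> ?A. y i ^ Poly_Mapping.lookup m' i)"
    by (simp add: lookup_add power_add prod.distrib)
  finally show ?thesis
    using monomial_superset[of ?A m y] monomial_superset[of ?A m' y] by simp
qed

lemma mult_eq_sum_single:
  fixes F G :: cpoly
  shows "F * G = (\<Sum>m \<in> Poly_Mapping.keys F. \<Sum>m' \<in> Poly_Mapping.keys G.
    Poly_Mapping.single (m + m') (Poly_Mapping.lookup F m * Poly_Mapping.lookup G m'))"
proof -
  have "F * G = (\<Sum>m \<in> Poly_Mapping.keys F. Poly_Mapping.single m (Poly_Mapping.lookup F m)) *
      (\<Sum>m \<in> Poly_Mapping.keys G. Poly_Mapping.single m (Poly_Mapping.lookup G m))"
    by (simp only: poly_mapping_sum_single)
  then show ?thesis
    by (simp add: sum_product mult_single)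
qed

lemma val_mult: "val (F * G) x = val F x * val G x"
  unfolding mult_eq_sum_single val_sum val_single monomial_add
  by (simp add: val_def mp_eval_def sum_product ac_simps)

lemma forms_mult:
  assumes "F \<in> forms n d" "G \<in> forms n e"
  shows "F * G \<in> forms n (d + e)"
  unfolding forms_def
proof (intro CollectI ballI)
  fix k assume "k \<in> Poly_Mapping.keys (F * G)"
  then obtain a b where ab: "a \<in> Poly_Mapping.keys F" "b \<in> Poly_Mapping.keys G" "k = a + b"
    using keys_mult[of F G] by blast
  let ?A = "Poly_Mapping.keys a \<union> Poly_Mapping.keys b"
  have A: "Poly_Mapping.keys a \<subseteq> {..n}" "Poly_Mapping.keys b \<subseteq> {..n}"
    "(\<Sum>i \<in> Poly_Mapping.keys a. Poly_Mapping.lookup a i) = d"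
    "(\<Sum>i \<in> Poly_Mapping.keys b. Poly_Mapping.lookup b i) = e"
    using assms ab by (auto simp: forms_def)
  have sub: "Poly_Mapping.keys k \<subseteq> ?A"
    unfolding ab by (rule keys_add)
  have sup: "(\<Sum>i \<in> Poly_Mapping.keys m. Poly_Mapping.lookup m i) =
      (\<Sum>i \<in> ?A. Poly_Mapping.lookup m i)" if "Poly_Mapping.keys m \<subseteq> ?A" for m :: "nat \<Rightarrow>\<^sub>0 nat"
    by (rule sum.mono_neutral_left) (use that in \<open>auto simp: in_keys_iff\<close>)
  have "(\<Sum>i \<in> Poly_Mapping.keys k. Poly_Mapping.lookup k i) = d + e"
    using sup[OF sub] sup[of a] sup[of b] A(3,4)
    by (simp add: ab(3) lookup_add sum.distrib)
  then show "Poly_Mapping.keys k \<subseteq> {..n} \<and>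
      (\<Sum>i \<in> Poly_Mapping.keys k. Poly_Mapping.lookup k i) = d + e"
    using sub A(1,2) by blast
qed

lemma lookup_scale: "Poly_Mapping.lookup (scale c v) k = c * Poly_Mapping.lookup v k"
  by (simp add: scale_def map.rep_eq when_def)

lemma val_scale:
  assumes "F \<in> forms n d"
  shows "val F (scale c x) = c ^ d * val F x"
proof -
  have "(\<Prod>i \<in> Poly_Mapping.keys m. (c * Poly_Mapping.lookup x i) ^ Poly_Mapping.lookup m i) =
      c ^ d * (\<Prod>i \<in> Poly_Mapping.keys m. Poly_Mapping.lookup x i ^ Poly_Mapping.lookup m i)"
    if "m \<in> Poly_Mapping.keys F" for m
    using that assms
    by (auto simp: forms_def power_mult_distrib prod.distrib simp flip: power_sum)
  then show ?thesis
    unfolding val_def mp_eval_def lookup_scale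
    by (simp add: sum_distrib_left ac_simps)
qed

lemma val_proj_class:
  assumes "F \<in> forms n d" "p \<in> proj_space n" "x \<in> p" "y \<in> p"
  shows "val F x = 0 \<longleftrightarrow> val F y = 0"
proof -
  obtain v where "p = proj_class v"
    using assms by (auto simp: proj_space_def projectivization_def)
  then obtain a b where "x = scale a v" "a \<noteq> 0" "y = scale b v" "b \<noteq> 0"
    using assms by (auto simp: proj_class_def)
  then show ?thesis
    using val_scale[OF assms(1)] by simp
qed

lemma istopology_zariski:
  "istopology (\<lambda>U. \<exists>S \<subseteq> (\<Union>e. forms n e). U = proj_space n - proj_zeros n S)"
  (is "istopology ?open")
  unfolding istopology_def
proof (intro conjI allI impI)
  fix U V assume "?open U" "?open V"
  then obtain S T where S: "S \<subseteq> (\<Union>e. forms n e)" "U = proj_space n - proj_zeros n S"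
    and T: "T \<subseteq> (\<Union>e. forms n e)" "V = proj_space n - proj_zeros n T"
    by blast
  let ?P = "{f * g | f g. f \<in> S \<and> g \<in> T}"
  have "?P \<subseteq> (\<Union>e. forms n e)"
  proof
    fix h assume "h \<in> ?P"
    then obtain f g where fg: "h = f * g" "f \<in> S" "g \<in> T" by blast
    then obtain d e where "f \<in> forms n d" "g \<in> forms n e"
      using S(1) T(1) by blast
    then have "h \<in> forms n (d + e)"
      using fg forms_mult by blast
    then show "h \<in> (\<Union>e. forms n e)" by blast
  qed
  moreover have "U \<inter> V = proj_space n - proj_zeros n ?P"
  proof (intro equalityI subsetI)
    fix p assume p: "p \<in> U \<inter> V"
    then obtain f g x y where f: "f \<in> S" "x \<in> p" "val f x \<noteq> 0"
      and g: "g \<in> T" "y \<in> p" "val g y \<noteq> 0" and pn: "p \<in> proj_space n"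
      using S(2) T(2) by (auto simp: proj_zeros_def)
    from g T(1) obtain e where "g \<in> forms n e" by blast
    then have "val g x \<noteq> 0"
      using val_proj_class pn f(2) g(2,3) by blast
    then have "val (f * g) x \<noteq> 0"
      using f(3) by (simp add: val_mult)
    then have "p \<notin> proj_zeros n ?P"
      using f(1,2) g(1) by (auto simp: proj_zeros_def)
    then show "p \<in> proj_space n - proj_zeros n ?P"
      using pn by blast
  next
    fix p assume "p \<in> proj_space n - proj_zeros n ?P"
    then show "p \<in> U \<inter> V"
      unfolding S(2) T(2) by (fastforce simp: proj_zeros_def val_mult)
  qed
  ultimately show "?open (U \<inter> V)" by blast
next
  fix K assume "\<forall>U \<in> K. ?open U"
  then obtain S where S: "\<And>U. U \<in> K \<Longrightarrow> S U \<subseteq> (\<Union>e. forms n e)"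
    "\<And>U. U \<in> K \<Longrightarrow> U = proj_space n - proj_zeros n (S U)"
    by metis
  have "\<Union>K = (\<Union>U \<in> K. proj_space n - proj_zeros n (S U))"
    using S(2) by auto
  also have "\<dots> = proj_space n - proj_zeros n (\<Union>U \<in> K. S U)"
    by (auto simp: proj_zeros_def)
  finally show "?open (\<Union>K)"
    using S(1) by (intro exI[of _ "\<Union>U \<in> K. S U"]) blast
qed

lemma openin_zariski:
  "openin (zariski n) U \<longleftrightarrow> (\<exists>S \<subseteq> (\<Union>e. forms n e). U = proj_space n - proj_zeros n S)"
  unfolding zariski_def topology_inverse'[OF istopology_zariski] ..

lemma topspace_zariski: "topspace (zariski n) = proj_space n"
proof
  show "topspace (zariski n) \<subseteq> proj_space n"
    using openin_topspace[of "zariski n"] unfolding openin_zariski by blast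
  have one: "1 \<in> forms n 0"
    by (auto simp: forms_def)
  have val_one: "val 1 x = 1" for x
    using val_single[of 0 1 x] by simp
  have "proj_zeros n {1} = {}"
  proof -
    have "\<exists>x. x \<in> p" if "p \<in> proj_space n" for p
      using that by (auto simp: proj_space_def projectivization_def proj_class_def)
    then show ?thesis
      by (auto simp: proj_zeros_def val_one)
  qed
  then have "openin (zariski n) (proj_space n)"
    unfolding openin_zariski using one by (intro exI[of _ "{1}"]) auto
  then show "proj_space n \<subseteq> topspace (zariski n)"
    by (rule openin_subset)
qed

lemma closedin_zariski:
  "closedin (zariski n) Z \<longleftrightarrow> (\<exists>S \<subseteq> (\<Union>e. forms n e). Z = proj_zeros n S)"
proof -
  have "proj_zeros n S \<subseteq> proj_space n" for S
    by (auto simp: proj_zeros_def)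
  then show ?thesis
    unfolding closedin_def topspace_zariski openin_zariski
    by (metis double_diff order_refl)
qed


section \<open>Codimension\<close>

definition irreducible_closedin :: "'a topology \<Rightarrow> 'a set \<Rightarrow> bool" where
  "irreducible_closedin X Z \<longleftrightarrow> closedin X Z \<and> Z \<noteq> {} \<and>
     (\<forall>A B. closedin X A \<and> closedin X B \<and> Z = A \<union> B \<longrightarrow> A = Z \<or> B = Z)"

text \<open>
  The codimension of an irreducible closed set \<open>Z\<close> is the supremum of the lengths \<open>k\<close> of chains
  \<open>Z = Z\<^sub>0 \<subset> \<dots> \<subset> Z\<^sub>k\<close> of irreducible closed sets; that of a closed set is the infimum over its
  irreducible closed subsets. For nonempty closed \<open>Z\<close> in \<open>\<bbbP>\<^sup>n\<close> this is \<open>n - dim Z\<close>.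
\<close>

definition irred_codim :: "'a topology \<Rightarrow> 'a set \<Rightarrow> enat" where
  "irred_codim X Z = Sup {enat k | k. \<exists>Y :: nat \<Rightarrow> 'a set. Y 0 = Z \<and>
     (\<forall>i \<le> k. irreducible_closedin X (Y i)) \<and> (\<forall>i < k. Y i \<subset> Y (Suc i))}"

definition codim :: "'a topology \<Rightarrow> 'a set \<Rightarrow> enat" where
  "codim X Z = Inf {irred_codim X Y | Y. irreducible_closedin X Y \<and> Y \<subseteq> Z}"

definition proj_codim :: "nat \<Rightarrow> cvec set set \<Rightarrow> enat" where
  "proj_codim n Z = (if Z = {} then enat (n + 1) else codim (zariski n) Z)"


section \<open>Symmetric geometric rank and tangency\<close>

definition sgr :: "nat \<Rightarrow> cpoly \<Rightarrow> enat" where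
  "sgr n F = proj_codim n (proj_zeros n {mp_deriv i F | i. i \<le> n})"

definition sgr_locus :: "nat \<Rightarrow> nat \<Rightarrow> nat \<Rightarrow> cpoly set set" where
  "sgr_locus n d r = {proj_class F | F. F \<in> forms n d \<and> F \<noteq> 0 \<and> sgr n F \<le> enat r}"

text \<open>
  The restriction of \<open>F\<close> to the line through \<open>[u]\<close> and \<open>[v]\<close> in the affine coordinate \<open>t\<close> in which
  the points other than \<open>[v]\<close> are \<open>[u + t v]\<close>. It is the zero polynomial iff \<open>F\<close> vanishes on
  the line; otherwise its order at \<open>t = 0\<close> is the multiplicity of the zero of \<open>F\<close>
  restricted to the line at \<open>[u]\<close>, whatever the auxiliary point \<open>[v]\<close>.
\<close>

definition line_restrict :: "cpoly \<Rightarrow> cvec \<Rightarrow> cvec \<Rightarrow> complex poly" where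
  "line_restrict F u v =
     mp_eval (\<lambda>c. [:c:]) (\<lambda>i. [:Poly_Mapping.lookup u i, Poly_Mapping.lookup v i:]) F"

definition tangent_to_line :: "nat \<Rightarrow> cpoly \<Rightarrow> cvec set set \<Rightarrow> bool" where
  "tangent_to_line n F l \<longleftrightarrow> l \<subseteq> proj_zeros n {F} \<or>
     (\<exists>u v. u \<noteq> 0 \<and> v \<noteq> 0 \<and> proj_class u \<in> l \<and> proj_class v \<in> l \<and> proj_class u \<noteq> proj_class v \<and>
        line_restrict F u v \<noteq> 0 \<and> order 0 (line_restrict F u v) \<ge> 2)"

definition tangent_hypersurfaces :: "nat \<Rightarrow> nat \<Rightarrow> cvec set set \<Rightarrow> cpoly set set" where
  "tangent_hypersurfaces n d l =
     {proj_class F | F. F \<in> forms n d \<and> F \<noteq> 0 \<and> tangent_to_line n F l}"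

end

theory Submission
  imports Defs
begin

text \<open>
  Both sides describe the forms with a repeated factor.

  If \<open>sgr F \<le> 1\<close>, some irreducible closed subset \<open>Y\<close> of the singular locus has codimension at most one.
  Unless \<open>Y\<close> is the whole space, a nonzero form of least degree vanishing on \<open>Y\<close> is irreducible and defines
  an irreducible closed set, so \<open>Y\<close> is that hypersurface (\<open>irred_codim_le_1\<close>). In both cases \<open>Y\<close> meets
  every line, and \<open>F\<close> is tangent to a line at any singular point on it (\<open>tangent_if_sgr_le_1\<close>).

  Conversely, let \<open>F\<close> be tangent to every line. Choose \<open>p\<close> with \<open>F(p) \<noteq> 0\<close> and \<open>p\<^sub>0 = 1\<close>, and view
  \<open>F(y + t p)\<close> as a polynomial \<open>f\<close> in \<open>t\<close> over \<open>R = \<complex>[y\<^sub>1, \<dots>, y\<^sub>n]\<close>. Tangency to the lines through \<open>p\<close>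
  says that \<open>f\<close> and its derivative \<open>f'\<close> have a common root at every point \<open>y\<close>. If no irreducible factor
  of positive degree of \<open>f\<close> divided \<open>f'\<close>, elimination of \<open>t\<close> would give a nonzero \<open>r \<in> R\<close> in the
  ideal \<open>(f, f')\<close>, and then \<open>r(y) = 0\<close> for all \<open>y\<close>, which is absurd. So an irreducible \<open>g\<close> divides
  \<open>f\<close> and \<open>f'\<close>, and since it cannot divide its own derivative, \<open>g\<^sup>2\<close> divides \<open>f\<close>
  (\<open>square_factor\<close>). The corresponding factor \<open>G\<close> of \<open>F\<close> is a form, \<open>F\<close> is singular along
  the hypersurface of \<open>G\<close>, and that hypersurface has codimension one (\<open>sgr_le_1_if_square_factor\<close>).

  The algebra behind both directions is that in \<open>\<complex>[x\<^sub>0, \<dots>, x\<^sub>n]\<close> irreducible elements are prime and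
  satisfy the Nullstellensatz: a polynomial that vanishes wherever the irreducible \<open>p\<close> does is a
  multiple of \<open>p\<close>. The type of polynomials has infinitely many variables, so the induction on the number of
  variables runs through subrings of it. The inductive step adjoins one variable
  (\<open>nullstellensatz_ring_poly\<close>) and is carried by a single fact, \<open>eliminate_variable\<close>: an irreducible
  \<open>f\<close> of positive degree that does not divide \<open>h\<close> generates together with \<open>h\<close> an ideal containing a
  nonzero constant of the coefficient ring.
\<close>

section \<open>Subrings, homomorphisms and divisibility\<close>

definition subring :: "'a::comm_ring_1 set \<Rightarrow> bool" where
  "subring S \<longleftrightarrow> 1 \<in> S \<and> (\<forall>a \<in> S. \<forall>b \<in> S. a - b \<in> S \<and> a * b \<in> S)"

lemma subringD:
  assumes "subring S"
  shows subring_1: "1 \<in> S" and subring_0: "0 \<in> S"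
    and subring_mult: "a \<in> S \<Longrightarrow> b \<in> S \<Longrightarrow> a * b \<in> S"
    and subring_diff: "a \<in> S \<Longrightarrow> b \<in> S \<Longrightarrow> a - b \<in> S"
    and subring_add: "a \<in> S \<Longrightarrow> b \<in> S \<Longrightarrow> a + b \<in> S"
    and subring_uminus: "a \<in> S \<Longrightarrow> - a \<in> S"
proof -
  show 1: "1 \<in> S" and m: "a \<in> S \<Longrightarrow> b \<in> S \<Longrightarrow> a * b \<in> S"
    and d: "\<And>a b. a \<in> S \<Longrightarrow> b \<in> S \<Longrightarrow> a - b \<in> S" for a b
    using assms by (auto simp: subring_def)
  show 0: "0 \<in> S"
    using d[OF 1 1] by simp
  show u: "- a \<in> S" if "a \<in> S" for a
    using d[OF 0 that] by simp
  show "a + b \<in> S" if "a \<in> S" "b \<in> S"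
    using d[OF that(1) u[OF that(2)]] by simp
qed

lemma subring_sum: "subring S \<Longrightarrow> (\<And>i. i \<in> A \<Longrightarrow> f i \<in> S) \<Longrightarrow> sum f A \<in> S"
  by (induction A rule: infinite_finite_induct) (auto intro: subring_0 subring_add)

lemma subring_prod: "subring S \<Longrightarrow> (\<And>i. i \<in> A \<Longrightarrow> f i \<in> S) \<Longrightarrow> prod f A \<in> S"
  by (induction A rule: infinite_finite_induct) (auto intro: subring_1 subring_mult)

lemma subring_power: "subring S \<Longrightarrow> a \<in> S \<Longrightarrow> a ^ k \<in> S"
  by (induction k) (auto intro: subring_1 subring_mult)

lemma subring_of_nat: "subring S \<Longrightarrow> of_nat k \<in> S"
  by (induction k) (auto intro: subring_0 subring_1 subring_add)

definition unital_hom :: "('a::comm_ring_1 \<Rightarrow> 'b::comm_ring_1) \<Rightarrow> bool" where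
  "unital_hom h \<longleftrightarrow> h 1 = 1 \<and> (\<forall>a b. h (a + b) = h a + h b \<and> h (a * b) = h a * h b)"

lemma unital_homD:
  assumes "unital_hom h"
  shows hom_1: "h 1 = 1" and hom_add: "h (a + b) = h a + h b" and hom_mult: "h (a * b) = h a * h b"
    and hom_0: "h 0 = 0" and hom_uminus: "h (- a) = - h a" and hom_diff: "h (a - b) = h a - h b"
proof -
  show "h 1 = 1" and a: "\<And>a b. h (a + b) = h a + h b" and "h (a * b) = h a * h b"
    using assms by (auto simp: unital_hom_def)
  show 0: "h 0 = 0"
    using a[of 0 0] by simp
  show u: "h (- a) = - h a" for a
    using a[of a "- a"] 0 by (simp add: eq_neg_iff_add_eq_0 add.commute)
  show "h (a - b) = h a - h b"
    using a[of a "- b"] u by simp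
qed

lemma hom_sum: "unital_hom h \<Longrightarrow> h (sum f A) = (\<Sum>i \<in> A. h (f i))"
  by (induction A rule: infinite_finite_induct) (auto simp: hom_0 hom_add)

lemma hom_prod: "unital_hom h \<Longrightarrow> h (prod f A) = (\<Prod>i \<in> A. h (f i))"
  by (induction A rule: infinite_finite_induct) (auto simp: hom_1 hom_mult)

lemma hom_power: "unital_hom h \<Longrightarrow> h (a ^ k) = h a ^ k"
  by (induction k) (auto simp: hom_1 hom_mult)

lemma hom_of_nat: "unital_hom h \<Longrightarrow> h (of_nat k) = of_nat k"
  by (induction k) (auto simp: hom_0 hom_1 hom_add)

lemma hom_comp: "unital_hom g \<Longrightarrow> unital_hom h \<Longrightarrow> unital_hom (\<lambda>a. g (h a))"
  by (simp add: unital_hom_def)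

lemma hom_pCons_0: "unital_hom (\<lambda>c. [:c:])"
  by (simp add: unital_hom_def one_pCons)

lemma hom_map_poly:
  assumes "unital_hom h"
  shows "unital_hom (map_poly h)"
  unfolding unital_hom_def using assms
  by (auto intro!: poly_eqI
      simp: coeff_map_poly hom_0 hom_1 hom_add hom_mult coeff_mult hom_sum coeff_1 if_distrib)

lemma hom_poly_map:
  assumes "unital_hom h"
  shows "unital_hom (\<lambda>p. poly (map_poly h p) t)"
  using hom_map_poly[OF assms] by (simp add: unital_hom_def)

text \<open>
  The notions are relative to a subring because the induction hypothesis on the number of variables concerns only
  quotients and factors that lie in it.
\<close>

definition dvd_in :: "'a::comm_ring_1 set \<Rightarrow> 'a \<Rightarrow> 'a \<Rightarrow> bool" where
  "dvd_in S a b \<longleftrightarrow> (\<exists>c \<in> S. b = a * c)"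

definition unit_in :: "'a::comm_ring_1 set \<Rightarrow> 'a \<Rightarrow> bool" where
  "unit_in S u \<longleftrightarrow> u \<in> S \<and> (\<exists>v \<in> S. u * v = 1)"

definition irreducible_in :: "'a::comm_ring_1 set \<Rightarrow> 'a \<Rightarrow> bool" where
  "irreducible_in S p \<longleftrightarrow> p \<in> S \<and> p \<noteq> 0 \<and> \<not> unit_in S p \<and>
     (\<forall>a \<in> S. \<forall>b \<in> S. p = a * b \<longrightarrow> unit_in S a \<or> unit_in S b)"

definition polys :: "'a::comm_ring_1 set \<Rightarrow> 'a poly set" where
  "polys S = {p. \<forall>i. coeff p i \<in> S}"

lemma dvd_in_mult: "subring S \<Longrightarrow> dvd_in S a b \<Longrightarrow> c \<in> S \<Longrightarrow> dvd_in S a (b * c)"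
  by (auto simp: dvd_in_def mult.assoc intro: subring_mult)

lemma dvd_in_diff: "subring S \<Longrightarrow> dvd_in S a b \<Longrightarrow> dvd_in S a c \<Longrightarrow> dvd_in S a (b - c)"
  unfolding dvd_in_def by (metis right_diff_distrib subring_diff)

lemma dvd_in_sum: "subring S \<Longrightarrow> (\<And>i. i \<in> A \<Longrightarrow> dvd_in S a (f i)) \<Longrightarrow> dvd_in S a (sum f A)"
proof (induction A rule: infinite_finite_induct)
  case (insert x A)
  then have "dvd_in S a (f x)" "dvd_in S a (sum f A)"
    by auto
  then obtain c c' where "c \<in> S" "f x = a * c" "c' \<in> S" "sum f A = a * c'"
    unfolding dvd_in_def by blast
  then have "sum f (insert x A) = a * (c + c')"
    using insert by (simp add: algebra_simps)
  then show ?case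
    using subring_add[OF insert.prems(1) \<open>c \<in> S\<close> \<open>c' \<in> S\<close>] unfolding dvd_in_def by blast
qed (use subring_0 in \<open>force simp: dvd_in_def\<close>)+

lemma unit_in_dvd:
  assumes "subring S" "unit_in S u" "a \<in> S" "b \<in> S" "a = b * u"
  shows "dvd_in S a b"
proof -
  obtain v where v: "v \<in> S" "u * v = 1"
    using assms by (auto simp: unit_in_def)
  then have "b = a * v"
    by (simp add: assms(5) mult.assoc)
  then show ?thesis
    using v by (auto simp: dvd_in_def)
qed

lemma subring_polys:
  assumes "subring S"
  shows "subring (polys S)"
  unfolding subring_def polys_def
  using assms
  by (auto simp: coeff_1 coeff_mult intro!: subring_sum subring_mult intro: subring_1 subring_0 subring_diff)

lemma const_in_polys: "subring S \<Longrightarrow> c \<in> S \<Longrightarrow> [:c:] \<in> polys S"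
  by (auto simp: polys_def coeff_pCons intro: subring_0 split: nat.splits)

lemma monom_in_polys: "subring S \<Longrightarrow> c \<in> S \<Longrightarrow> monom c k \<in> polys S"
  by (auto simp: polys_def intro: subring_0)

lemma smult_in_polys: "subring S \<Longrightarrow> c \<in> S \<Longrightarrow> p \<in> polys S \<Longrightarrow> smult c p \<in> polys S"
  by (auto simp: polys_def intro: subring_mult)

lemma pderiv_in_polys: "subring S \<Longrightarrow> p \<in> polys S \<Longrightarrow> pderiv p \<in> polys S"
  unfolding polys_def mem_Collect_eq coeff_pderiv by (metis subring_mult subring_of_nat)

lemma unit_in_polys:
  fixes S :: "'a::idom set"
  assumes "subring S"
  shows "unit_in (polys S) p \<longleftrightarrow> (\<exists>c. p = [:c:] \<and> unit_in S c)"
proof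
  assume "unit_in (polys S) p"
  then obtain q where q: "p \<in> polys S" "q \<in> polys S" "p * q = 1"
    by (auto simp: unit_in_def)
  then have "degree p + degree q = 0"
    by (metis degree_1 degree_mult_eq mult_eq_0_iff zero_neq_one)
  then obtain c d where "p = [:c:]" "q = [:d:]"
    by (metis add_is_0 degree_eq_zeroE)
  moreover from this have "c * d = 1"
    using q(3) by (simp add: one_pCons mult.commute)
  moreover have "c \<in> S" "d \<in> S"
    using q(1,2) calculation(1,2) by (auto simp: polys_def dest: spec[of _ 0])
  ultimately show "\<exists>c. p = [:c:] \<and> unit_in S c"
    by (auto simp: unit_in_def)
next
  assume "\<exists>c. p = [:c:] \<and> unit_in S c"
  then obtain c d where "p = [:c:]" "c \<in> S" "d \<in> S" "c * d = 1"
    by (auto simp: unit_in_def)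
  moreover from this have "p * [:d:] = 1"
    by (simp add: one_pCons mult.commute)
  ultimately show "unit_in (polys S) p"
    using const_in_polys[OF assms] unfolding unit_in_def by blast
qed

text \<open>
  The quotients of the coefficients have to be chosen in \<open>S\<close>, hence the explicit construction of \<open>q\<close>.
\<close>

lemma const_dvd_in_polys:
  assumes "subring S" "\<And>i. dvd_in S c (coeff p i)"
  shows "\<exists>q \<in> polys S. p = smult c q"
proof -
  obtain k where k: "\<And>i. k i \<in> S" "\<And>i. coeff p i = c * k i"
    using assms(2) unfolding dvd_in_def by metis
  define q where "q = (\<Sum>i \<le> degree p. monom (k i) i)"
  have "q \<in> polys S"
    unfolding q_def using assms(1) k by (intro subring_sum subring_polys monom_in_polys)
  moreover have "p = smult c q"
  proof -
    have "p = (\<Sum>i \<le> degree p. monom (coeff p i) i)"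
      by (rule poly_as_sum_of_monoms[symmetric])
    also have "\<dots> = (\<Sum>i \<le> degree p. smult c (monom (k i) i))"
      by (simp add: k(2) smult_monom)
    also have "\<dots> = smult c q"
      using sum_distrib_left[of "[:c:]" "\<lambda>i. monom (k i) i" "{..degree p}"] by (simp add: q_def)
    finally show ?thesis .
  qed
  ultimately show ?thesis
    by blast
qed

text \<open>
  Division with remainder over an integral domain works once \<open>f\<close> is multiplied by a power of the leading
  coefficient of \<open>g\<close>. All the operations stay inside \<open>S\<close>.
\<close>

lemma pseudo_division_in_polys:
  fixes S :: "'a::idom set"
  assumes S: "subring S" and g: "g \<in> polys S" "degree g > 0" and f: "f \<in> polys S"
  shows "\<exists>c q r. c \<in> S \<and> c \<noteq> 0 \<and> q \<in> polys S \<and> r \<in> polys S \<and>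
    smult c f = q * g + r \<and> degree r < degree g"
  using f
proof (induction "degree f" arbitrary: f rule: less_induct)
  case less
  note P = subring_polys[OF S]
  show ?case
  proof (cases "degree f < degree g")
    case True
    then show ?thesis
      using less.prems S P
      by (intro exI[of _ 1] exI[of _ 0] exI[of _ f]) (auto intro: subring_1 subring_0)
  next
    case False
    let ?b = "lead_coeff g" and ?m = "monom (lead_coeff f) (degree f - degree g)"
    define f' where "f' = smult ?b f - ?m * g"
    have b: "?b \<in> S" "?b \<noteq> 0" and a: "lead_coeff f \<in> S"
      using g less.prems by (auto simp: polys_def)
    then have m: "?m \<in> polys S"
      using S by (intro monom_in_polys)
    then have f': "f' \<in> polys S"
      unfolding f'_def using S P b(1) less.prems g(1)
      by (intro subring_diff subring_mult smult_in_polys)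
    have "degree f' < degree f"
    proof -
      have f0: "degree f > 0"
        using False g(2) by simp
      then have lf: "lead_coeff f \<noteq> 0"
        by auto
      have eq: "degree (?m * g) = degree f"
        using False lf g(2) by (subst degree_mult_eq) (auto simp: degree_monom_eq)
      have "degree f' \<le> degree f"
        unfolding f'_def using eq by (intro degree_diff_le) auto
      moreover have "coeff f' (degree f) = 0"
      proof -
        have "coeff (?m * g) (degree f) = lead_coeff f * ?b"
          using lead_coeff_mult[of ?m g] unfolding eq by (simp add: degree_monom_eq[OF lf])
        then show ?thesis
          by (simp add: f'_def mult.commute)
      qed
      ultimately show ?thesis
        using f0 by (metis le_neq_implies_less degree_0 leading_coeff_0_iff)
    qed
    then obtain c q r where IH: "c \<in> S" "c \<noteq> 0" "q \<in> polys S" "r \<in> polys S"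
      "smult c f' = q * g + r" "degree r < degree g"
      using less.hyps[OF _ f'] by blast
    have "smult (c * ?b) f = smult c f' + smult c ?m * g"
      by (simp only: f'_def smult_diff_right smult_smult mult_smult_left diff_add_cancel)
    then have "smult (c * ?b) f = (smult c ?m + q) * g + r"
      unfolding IH(5) by (simp only: distrib_right add.assoc add.commute add.left_commute)
    moreover have "c * ?b \<in> S" "c * ?b \<noteq> 0"
      using IH(1,2) b subring_mult[OF S] by auto
    moreover have "smult c ?m + q \<in> polys S"
      by (intro subring_add[OF P] smult_in_polys[OF S] IH m)
    ultimately show ?thesis
      using IH(4,6) by blast
  qed
qed


section \<open>Rings with unique factorization and a Nullstellensatz\<close>

text \<open>
  If \<open>E\<close> is the set of points of an affine space, acting on functions by evaluation, then \<open>poly_evals E\<close> is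
  the set of points of that space times a line.
\<close>

definition poly_evals :: "('a::comm_ring_1 \<Rightarrow> complex) set \<Rightarrow> ('a poly \<Rightarrow> complex) set" where
  "poly_evals E = {\<lambda>p. poly (map_poly e p) t | e t. e \<in> E}"

text \<open>
  The invariant of the induction on the number of variables. The elements of \<open>E\<close> play the role of the points at
  which elements of \<open>S\<close> are evaluated. An additive measure that detects units, such as the degree, is
  a convenient form of the ascending chain condition: it makes factorization into irreducibles terminate,
  and it passes to polynomials by adding the degree to the measure of the leading coefficient.
\<close>

locale nullstellensatz_ring =
  fixes S :: "'a::idom set" and E :: "('a \<Rightarrow> complex) set"
  assumes subring: "subring S"
    and factor_count: "\<exists>w :: 'a \<Rightarrow> nat. (\<forall>a \<in> S - {0}. \<forall>b \<in> S - {0}. w (a * b) = w a + w b) \<and>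
      (\<forall>a \<in> S - {0}. w a = 0 \<longrightarrow> unit_in S a)"
    and prime: "irreducible_in S p \<Longrightarrow> a \<in> S \<Longrightarrow> b \<in> S \<Longrightarrow> dvd_in S p (a * b) \<Longrightarrow>
      dvd_in S p a \<or> dvd_in S p b"
    and hom: "e \<in> E \<Longrightarrow> unital_hom e"
    and separating: "a \<in> S \<Longrightarrow> a \<noteq> 0 \<Longrightarrow> \<exists>e \<in> E. e a \<noteq> 0"
    and nullstellensatz: "irreducible_in S p \<Longrightarrow> h \<in> S \<Longrightarrow> (\<And>e. e \<in> E \<Longrightarrow> e p = 0 \<Longrightarrow> e h = 0) \<Longrightarrow>
      dvd_in S p h"
begin

lemma factor_induct [consumes 2, case_names unit irreducible]:
  assumes "a \<in> S" "a \<noteq> 0"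
    and unit: "\<And>u. unit_in S u \<Longrightarrow> P u"
    and irr: "\<And>p a. irreducible_in S p \<Longrightarrow> a \<in> S \<Longrightarrow> a \<noteq> 0 \<Longrightarrow> P a \<Longrightarrow> P (p * a)"
  shows "P a"
proof -
  obtain w :: "'a \<Rightarrow> nat" where w: "\<And>a b. a \<in> S \<Longrightarrow> b \<in> S \<Longrightarrow> a \<noteq> 0 \<Longrightarrow> b \<noteq> 0 \<Longrightarrow> w (a * b) = w a + w b"
    "\<And>a. a \<in> S \<Longrightarrow> a \<noteq> 0 \<Longrightarrow> w a = 0 \<Longrightarrow> unit_in S a"
    using factor_count by auto
  have smaller: "w a < w (a * b) \<and> w b < w (a * b)"
    if "a \<in> S" "b \<in> S" "a * b \<noteq> 0" "\<not> unit_in S a" "\<not> unit_in S b" for a b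
    using that w(1)[of a b] w(2)[of a] w(2)[of b] by auto
  have ex: "\<exists>p b. irreducible_in S p \<and> b \<in> S \<and> a = p * b"
    if "a \<in> S" "a \<noteq> 0" "\<not> unit_in S a" for a
    using that
  proof (induction "w a" arbitrary: a rule: less_induct)
    case less
    show ?case
    proof (cases "irreducible_in S a")
      case True
      then show ?thesis
        by (intro exI[of _ a] exI[of _ 1]) (auto intro: subring_1[OF subring])
    next
      case False
      then obtain x y where xy: "x \<in> S" "y \<in> S" "a = x * y" "\<not> unit_in S x" "\<not> unit_in S y"
        using less.prems by (auto simp: irreducible_in_def)
      then obtain p b where "irreducible_in S p" "b \<in> S" "x = p * b"
        using less smaller[of x y] by (metis mult_eq_0_iff)
      then show ?thesis
        using xy subring_mult[OF subring] by (metis mult.assoc)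
    qed
  qed
  show ?thesis
    using assms(1,2)
  proof (induction "w a" arbitrary: a rule: less_induct)
    case less
    show ?case
    proof (cases "unit_in S a")
      case False
      then obtain p b where pb: "irreducible_in S p" "b \<in> S" "a = p * b"
        using ex less.prems by blast
      moreover have "w b < w a"
        using pb less.prems w(1)[of p b] w(2)[of p] by (auto simp: irreducible_in_def)
      ultimately show ?thesis
        using less irr by auto
    qed (rule unit)
  qed
qed

text \<open>
  Gauss's lemma: modulo the prime \<open>p\<close> the lowest nonzero coefficients of \<open>a\<close> and \<open>b\<close> multiply to a nonzero
  coefficient of the product.
\<close>

lemma gauss:
  assumes p: "irreducible_in S p" and a: "a \<in> polys S" and b: "b \<in> polys S"
    and dvd: "\<And>i. dvd_in S p (coeff (a * b) i)"
  shows "(\<forall>i. dvd_in S p (coeff a i)) \<or> (\<forall>i. dvd_in S p (coeff b i))"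
proof (rule ccontr)
  assume *: "\<not> ?thesis"
  define i where "i = (LEAST i. \<not> dvd_in S p (coeff a i))"
  define j where "j = (LEAST j. \<not> dvd_in S p (coeff b j))"
  have i: "\<not> dvd_in S p (coeff a i)" and j: "\<not> dvd_in S p (coeff b j)"
    unfolding i_def j_def using * by (rule_tac LeastI_ex; blast)+
  have lt: "dvd_in S p (coeff a k)" if "k < i" for k
    using that not_less_Least unfolding i_def by blast
  have lt': "dvd_in S p (coeff b k)" if "k < j" for k
    using that not_less_Least unfolding j_def by blast
  have S: "coeff a k \<in> S" "coeff b k \<in> S" for k
    using a b by (auto simp: polys_def)
  let ?A = "{..i + j} - {i}"
  have "coeff (a * b) (i + j) = coeff a i * coeff b j + (\<Sum>k \<in> ?A. coeff a k * coeff b (i + j - k))"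
    unfolding coeff_mult by (subst sum.remove[of _ i]) auto
  moreover have "dvd_in S p (\<Sum>k \<in> ?A. coeff a k * coeff b (i + j - k))"
  proof (rule dvd_in_sum[OF subring])
    fix k assume k: "k \<in> ?A"
    show "dvd_in S p (coeff a k * coeff b (i + j - k))"
    proof (cases "k < i")
      case True
      then show ?thesis
        by (intro dvd_in_mult[OF subring] lt S)
    next
      case False
      then have "dvd_in S p (coeff b (i + j - k) * coeff a k)"
        using k by (intro dvd_in_mult[OF subring] lt' S) auto
      then show ?thesis
        by (simp add: mult.commute)
    qed
  qed
  ultimately have "dvd_in S p (coeff a i * coeff b j)"
    using dvd_in_diff[OF subring dvd[of "i + j"]] by fastforce
  then show False
    using prime[OF p S(1)[of i] S(2)[of j]] i j by blast
qed

lemma subring_poly: "subring (polys S)"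
  by (rule subring_polys[OF subring])

text \<open>
  A constant can be removed from a factorization over the fraction field: by Gauss's lemma each
  irreducible factor of \<open>c\<close> divides \<open>q\<close> or \<open>r\<close>, and is cancelled there. What is cancelled from \<open>r\<close>
  is collected in \<open>c'\<close>.
\<close>

lemma cancel_const:
  assumes "c \<in> S" "c \<noteq> 0" "q \<in> polys S" "r \<in> polys S" "f \<in> polys S" "smult c f = q * r"
  shows "\<exists>c' q' r'. c' \<in> S \<and> q' \<in> polys S \<and> r' \<in> polys S \<and> f = q' * r' \<and> r = smult c' r'"
  using assms
proof (induction arbitrary: q r rule: factor_induct)
  case (unit u)
  then obtain v where v: "v \<in> S" "u * v = 1"
    by (auto simp: unit_in_def)
  have "f = smult (u * v) f"
    using v by simp
  also have "\<dots> = smult v (smult u f)"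
    by (simp add: mult.commute)
  also have "\<dots> = smult v q * r"
    using unit by simp
  finally have "f = smult v q * r" .
  moreover have "smult v q \<in> polys S"
    by (rule smult_in_polys[OF subring v(1) unit.prems(1)])
  moreover have "r = smult 1 r"
    by simp
  ultimately show ?case
    using unit.prems(2) subring_1[OF subring] by blast
next
  case (irreducible p a)
  have p: "p \<in> S" "p \<noteq> 0"
    using irreducible by (auto simp: irreducible_in_def)
  have dvd: "dvd_in S p (coeff (q * r) i)" for i
  proof -
    have "coeff (q * r) i = p * (a * coeff f i)"
      using arg_cong[OF irreducible.prems(4), of "\<lambda>p. coeff p i"] by (simp add: mult.assoc)
    moreover have "a * coeff f i \<in> S"
      using irreducible by (auto simp: polys_def intro: subring_mult[OF subring])
    ultimately show ?thesis
      by (auto simp: dvd_in_def)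
  qed
  then consider "\<forall>i. dvd_in S p (coeff q i)" | "\<forall>i. dvd_in S p (coeff r i)"
    using gauss irreducible by blast
  then show ?case
  proof cases
    case 1
    then obtain q' where q': "q' \<in> polys S" "q = smult p q'"
      using const_dvd_in_polys[OF subring] by blast
    then have "smult p (smult a f) = smult p (q' * r)"
      using irreducible.prems by simp
    then have "smult a f = q' * r"
      using p by (simp only: smult_cancel[OF p(2)])
    then show ?thesis
      using irreducible q' by blast
  next
    case 2
    then obtain r' where r': "r' \<in> polys S" "r = smult p r'"
      using const_dvd_in_polys[OF subring] by blast
    then have "smult p (smult a f) = smult p (q * r')"
      using irreducible.prems by simp
    then have "smult a f = q * r'"
      using p by (simp only: smult_cancel[OF p(2)])
    then obtain c' q1 r1 where "c' \<in> S" "q1 \<in> polys S" "r1 \<in> polys S" "f = q1 * r1"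
      "r' = smult c' r1"
      using irreducible r' by metis
    moreover have "r = smult (p * c') r1"
      using calculation r' by simp
    ultimately show ?thesis
      using subring_mult[OF subring p(1)] by blast
  qed
qed

lemma irreducible_dvd_cancel_const:
  assumes f: "irreducible_in (polys S) f" "degree f > 0" and c: "c \<in> S" "c \<noteq> 0" and h: "h \<in> polys S"
    and dvd: "dvd_in (polys S) f (smult c h)"
  shows "dvd_in (polys S) f h"
proof -
  have fS: "f \<in> polys S"
    using f by (simp add: irreducible_in_def)
  obtain g where "g \<in> polys S" "smult c h = g * f"
    using dvd by (auto simp: dvd_in_def mult.commute)
  then obtain c' q r where qr: "c' \<in> S" "q \<in> polys S" "r \<in> polys S" "h = q * r" "f = smult c' r"
    using cancel_const[OF c _ fS h] by blast
  then have f_eq: "f = r * [:c':]"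
    by simp
  have "degree r > 0"
    using f(2) qr(5) by (metis degree_smult_le gr0I le_0_eq)
  then have "\<not> unit_in (polys S) r"
    by (auto simp: unit_in_polys[OF subring])
  then have "unit_in (polys S) [:c':]"
    using f(1) f_eq qr(3) const_in_polys[OF subring qr(1)] unfolding irreducible_in_def by blast
  then have "dvd_in (polys S) f r"
    using unit_in_dvd[OF subring_poly _ fS qr(3) f_eq] by blast
  then have "dvd_in (polys S) f (r * q)"
    by (rule dvd_in_mult[OF subring_poly _ qr(2)])
  then show ?thesis
    using qr(4) by (simp add: mult.commute)
qed

text \<open>
  Take an element \<open>r\<close> of least degree in the ideal \<open>(f, h)\<close>. If its degree were positive, pseudo-division would show
  that \<open>r\<close> divides multiples \<open>c f\<close> and \<open>d h\<close> by nonzero constants. Cancelling \<open>c\<close>, irreducibility makes \<open>f\<close>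
  a divisor of \<open>r\<close>, so of \<open>d h\<close>, and cancelling \<open>d\<close> a divisor of \<open>h\<close>. So \<open>r\<close> is a constant. This
  takes the place of the resultant of \<open>f\<close> and \<open>h\<close>.
\<close>

lemma eliminate_variable:
  assumes f: "irreducible_in (polys S) f" "degree f > 0" and h: "h \<in> polys S"
    and ndvd: "\<not> dvd_in (polys S) f h"
  shows "\<exists>r u v. r \<in> S \<and> r \<noteq> 0 \<and> u \<in> polys S \<and> v \<in> polys S \<and> [:r:] = u * f + v * h"
proof -
  have fS: "f \<in> polys S" "f \<noteq> 0"
    using f by (auto simp: irreducible_in_def)
  define I where "I = {u * f + v * h | u v. u \<in> polys S \<and> v \<in> polys S}"
  have I_sub: "I \<subseteq> polys S"
    unfolding I_def using fS h by (auto intro!: subring_add subring_mult subring_poly)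
  have I_comb: "a * p + b * q \<in> I" if pq: "p \<in> I" "q \<in> I" and ab: "a \<in> polys S" "b \<in> polys S" for a b p q
  proof -
    obtain u v where "p = u * f + v * h" "u \<in> polys S" "v \<in> polys S"
      using pq(1) unfolding I_def by blast
    moreover obtain u' v' where "q = u' * f + v' * h" "u' \<in> polys S" "v' \<in> polys S"
      using pq(2) unfolding I_def by blast
    ultimately show ?thesis
      unfolding I_def using ab
      by (intro CollectI exI[of _ "a * u + b * u'"] exI[of _ "a * v + b * v'"])
        (auto simp: algebra_simps intro!: subring_add[OF subring_poly] subring_mult[OF subring_poly])
  qed
  have fI: "f \<in> I" and hI: "h \<in> I"
    unfolding I_def using subring_0[OF subring_poly] subring_1[OF subring_poly]
    by (force intro: exI[of _ 1] exI[of _ 0])+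
  define r where "r = (ARG_MIN degree r. r \<in> I - {0})"
  have r: "r \<in> I" "r \<noteq> 0"
    using arg_min_natI[of "\<lambda>r. r \<in> I - {0}" f degree] fI fS by (auto simp: r_def)
  have min: "degree r \<le> degree s" if "s \<in> I" "s \<noteq> 0" for s
    using arg_min_nat_le[of "\<lambda>r. r \<in> I - {0}" s degree] that by (auto simp: r_def)
  have rS: "r \<in> polys S"
    using r I_sub by blast
  have "degree r = 0"
  proof (rule ccontr)
    assume "degree r \<noteq> 0"
    then have deg: "degree r > 0" by simp
    have divides: "\<exists>c q. c \<in> S \<and> c \<noteq> 0 \<and> q \<in> polys S \<and> smult c p = q * r" if pI: "p \<in> I" for p
    proof -
      have "p \<in> polys S"
        using pI I_sub by blast
      then obtain c q s where c: "c \<in> S" "c \<noteq> 0" "q \<in> polys S" "s \<in> polys S"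
        "smult c p = q * r + s" "degree s < degree r"
        using pseudo_division_in_polys[OF subring rS deg] by metis
      have "[:c:] * p + (- q) * r \<in> I"
        using c pI r by (intro I_comb const_in_polys[OF subring] subring_uminus[OF subring_poly])
      moreover have "[:c:] * p + (- q) * r = s"
        using c by simp
      ultimately have "s = 0"
        using min[of s] c(6) by fastforce
      then show ?thesis
        using c by auto
    qed
    obtain c q where "c \<in> S" "c \<noteq> 0" "q \<in> polys S" "smult c f = q * r"
      using divides[OF fI] by blast
    then obtain c' q' r' where q': "c' \<in> S" "q' \<in> polys S" "r' \<in> polys S" "f = q' * r'"
      "r = smult c' r'"
      using cancel_const[OF _ _ _ rS fS(1)] by blast
    have "degree r' > 0"
      using deg q'(5) by (metis degree_smult_le gr0I le_0_eq)
    then have "\<not> unit_in (polys S) r'"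
      by (auto simp: unit_in_polys[OF subring])
    then have "unit_in (polys S) q'"
      using f(1) q' unfolding irreducible_in_def by blast
    then have "dvd_in (polys S) f r'"
      using unit_in_dvd[OF subring_poly _ fS(1) q'(3)] q'(4) by (metis mult.commute)
    then have "dvd_in (polys S) f (r' * [:c':])"
      by (rule dvd_in_mult[OF subring_poly _ const_in_polys[OF subring q'(1)]])
    then have f_dvd_r: "dvd_in (polys S) f r"
      by (simp add: q'(5))
    obtain d k where d: "d \<in> S" "d \<noteq> 0" "k \<in> polys S" "smult d h = r * k"
      using divides[OF hI] by (auto simp: mult.commute)
    have "dvd_in (polys S) f (smult d h)"
      unfolding d(4) by (rule dvd_in_mult[OF subring_poly f_dvd_r d(3)])
    then show False
      using irreducible_dvd_cancel_const[OF f d(1,2) h] ndvd by blast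
  qed
  then obtain c where c: "r = [:c:]"
    by (metis degree_eq_zeroE)
  then have "c \<in> S" "c \<noteq> 0"
    using rS r(2) by (auto simp: polys_def dest: spec[of _ 0])
  then show ?thesis
    using r(1) c by (auto simp: I_def)
qed

lemma irreducible_const:
  assumes "irreducible_in (polys S) [:p:]"
  shows "irreducible_in S p"
  unfolding irreducible_in_def
proof (intro conjI ballI impI)
  show "p \<in> S"
    using assms by (auto simp: irreducible_in_def polys_def dest: spec[of _ 0])
  show "p \<noteq> 0" "\<not> unit_in S p"
    using assms by (auto simp: irreducible_in_def unit_in_polys[OF subring])
  fix a b assume ab: "a \<in> S" "b \<in> S" "p = a * b"
  then have "[:p:] = [:a:] * [:b:]"
    by simp
  then have "unit_in (polys S) [:a:] \<or> unit_in (polys S) [:b:]"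
    using assms ab const_in_polys[OF subring] unfolding irreducible_in_def by blast
  then show "unit_in S a \<or> unit_in S b"
    by (simp add: unit_in_polys[OF subring])
qed

lemma dvd_in_polys_const:
  assumes "p \<in> S" "a \<in> polys S"
  shows "dvd_in (polys S) [:p:] a \<longleftrightarrow> (\<forall>i. dvd_in S p (coeff a i))"
proof
  assume "dvd_in (polys S) [:p:] a"
  then show "\<forall>i. dvd_in S p (coeff a i)"
    by (auto simp: dvd_in_def polys_def)
next
  assume "\<forall>i. dvd_in S p (coeff a i)"
  then show "dvd_in (polys S) [:p:] a"
    using const_dvd_in_polys[OF subring, of p a] by (auto simp: dvd_in_def)
qed

text \<open>
  If \<open>f\<close> of positive degree divides neither \<open>a\<close> nor \<open>b\<close>, elimination gives nonzero constants \<open>r \<in> (f, a)\<close> and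
  \<open>s \<in> (f, b)\<close>. Their product lies in \<open>(f, a b) = (f)\<close>, which is impossible for degree reasons. For constant \<open>f\<close>
  this is Gauss's lemma.
\<close>

lemma prime_poly:
  assumes f: "irreducible_in (polys S) f" and a: "a \<in> polys S" and b: "b \<in> polys S"
    and dvd: "dvd_in (polys S) f (a * b)"
  shows "dvd_in (polys S) f a \<or> dvd_in (polys S) f b"
proof (cases "degree f = 0")
  case True
  then obtain p where p: "f = [:p:]"
    by (metis degree_eq_zeroE)
  then have irr: "irreducible_in S p"
    using f irreducible_const by blast
  then have pS: "p \<in> S"
    by (simp add: irreducible_in_def)
  show ?thesis
    using gauss[OF irr a b] dvd subring_mult[OF subring_poly a b]
    unfolding p by (simp add: dvd_in_polys_const pS a b)
next
  case False
  then have deg: "degree f > 0" by simp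
  show ?thesis
  proof (rule ccontr)
    assume "\<not> ?thesis"
    then obtain r u v s u' v' where *: "r \<noteq> 0" "[:r:] = u * f + v * a" "u \<in> polys S" "v \<in> polys S"
      "s \<noteq> 0" "[:s:] = u' * f + v' * b" "u' \<in> polys S" "v' \<in> polys S"
      using eliminate_variable[OF f deg a] eliminate_variable[OF f deg b] by metis
    obtain k where k: "a * b = f * k"
      using dvd by (auto simp: dvd_in_def)
    have "[:r:] * [:s:] = (u * f + v * a) * (u' * f + v' * b)"
      using * by simp
    also have "\<dots> = f * (u * u' * f + u * v' * b + v * a * u') + v * v' * (a * b)"
      by (simp add: algebra_simps)
    also have "\<dots> = f * (u * u' * f + u * v' * b + v * a * u' + v * v' * k)"
      unfolding k by (simp add: algebra_simps)
    finally have "f dvd [:r * s:]"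
      by (simp add: dvd_def mult.commute)
    then have "degree f \<le> degree [:r * s:]"
      using * by (intro dvd_imp_degree_le) auto
    then show False
      using deg by simp
  qed
qed

text \<open>
  Let \<open>f\<close> have positive degree and not divide \<open>h\<close>, and let \<open>r \<noteq> 0\<close> be a constant in \<open>(f, h)\<close>. At a point where
  neither \<open>r\<close> nor the leading coefficient of \<open>f\<close> vanishes, \<open>f\<close> still has positive degree and so has a root
  \<open>t\<close>. There \<open>h\<close> vanishes too, and therefore \<open>r\<close>, a contradiction. For constant \<open>f\<close> the claim is checked on each
  coefficient of \<open>h\<close>.
\<close>

lemma nullstellensatz_poly:
  assumes f: "irreducible_in (polys S) f" and h: "h \<in> polys S"
    and vanish: "\<And>e. e \<in> poly_evals E \<Longrightarrow> e f = 0 \<Longrightarrow> e h = 0"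
  shows "dvd_in (polys S) f h"
proof (cases "degree f = 0")
  case True
  then obtain p where p: "f = [:p:]"
    by (metis degree_eq_zeroE)
  then have irr: "irreducible_in S p"
    using f irreducible_const by blast
  have "dvd_in S p (coeff h i)" for i
  proof (rule nullstellensatz[OF irr])
    show "coeff h i \<in> S"
      using h by (simp add: polys_def)
    fix e assume e: "e \<in> E" "e p = 0"
    note he = hom[OF e(1)]
    have "poly (map_poly e h) t = 0" for t
    proof (rule vanish)
      show "(\<lambda>p. poly (map_poly e p) t) \<in> poly_evals E"
        using e by (auto simp: poly_evals_def)
      show "poly (map_poly e f) t = 0"
        using e by (simp add: p map_poly_pCons hom_0[OF he])
    qed
    then have "map_poly e h = 0"
      using poly_all_0_iff_0 by blast
    then show "e (coeff h i) = 0"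
      using coeff_map_poly[of e h i] hom_0[OF he] by simp
  qed
  then show ?thesis
    unfolding p using irr h by (subst dvd_in_polys_const) (auto simp: irreducible_in_def)
next
  case False
  then have deg: "degree f > 0" by simp
  show ?thesis
  proof (rule ccontr)
    assume "\<not> ?thesis"
    then obtain r u v where *: "r \<in> S" "r \<noteq> 0" "[:r:] = u * f + v * h"
      using eliminate_variable[OF f deg h] by blast
    have "lead_coeff f \<in> S" "lead_coeff f \<noteq> 0"
      using f by (auto simp: irreducible_in_def polys_def)
    then obtain e where e: "e \<in> E" "e (r * lead_coeff f) \<noteq> 0"
      using separating[of "r * lead_coeff f"] * subring_mult[OF subring] by auto
    note he = hom[OF e(1)]
    have er: "e r \<noteq> 0" "e (lead_coeff f) \<noteq> 0"
      using e(2) by (auto simp: hom_mult[OF he])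
    have "coeff (map_poly e f) (degree f) \<noteq> 0"
      using er by (simp add: coeff_map_poly hom_0[OF he])
    then have "degree (map_poly e f) \<noteq> 0"
      using deg le_degree by fastforce
    then obtain t where t: "poly (map_poly e f) t = 0"
      by (metis constant_degree fundamental_theorem_of_algebra)
    note ht = hom_poly_map[OF he, of t]
    have "poly (map_poly e h) t = 0"
      using vanish[of "\<lambda>p. poly (map_poly e p) t"] e t by (auto simp: poly_evals_def)
    then have "poly (map_poly e [:r:]) t = 0"
      unfolding *(3) using t hom_add[OF ht] hom_mult[OF ht] by simp
    then show False
      using er by (simp add: map_poly_pCons hom_0[OF he])
  qed
qed

theorem nullstellensatz_ring_poly: "nullstellensatz_ring (polys S) (poly_evals E)"
proof
  show "subring (polys S)"
    by (rule subring_poly)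
  show "irreducible_in (polys S) p \<Longrightarrow> a \<in> polys S \<Longrightarrow> b \<in> polys S \<Longrightarrow> dvd_in (polys S) p (a * b) \<Longrightarrow>
      dvd_in (polys S) p a \<or> dvd_in (polys S) p b" for p a b
    by (rule prime_poly)
  show "irreducible_in (polys S) p \<Longrightarrow> h \<in> polys S \<Longrightarrow>
      (\<And>e. e \<in> poly_evals E \<Longrightarrow> e p = 0 \<Longrightarrow> e h = 0) \<Longrightarrow> dvd_in (polys S) p h" for p h
    by (rule nullstellensatz_poly)
  show "unital_hom e" if "e \<in> poly_evals E" for e
    using that hom_poly_map[OF hom] by (auto simp: poly_evals_def)
  show "\<exists>e \<in> poly_evals E. e a \<noteq> 0" if a: "a \<in> polys S" "a \<noteq> 0" for a
  proof -
    obtain e where e: "e \<in> E" "e (lead_coeff a) \<noteq> 0"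
      using a separating[of "lead_coeff a"] by (auto simp: polys_def)
    then have "coeff (map_poly e a) (degree a) \<noteq> 0"
      using coeff_map_poly[of e a] hom_0[OF hom[OF e(1)]] by simp
    then have "map_poly e a \<noteq> 0"
      by (metis coeff_0)
    then obtain t where "poly (map_poly e a) t \<noteq> 0"
      using poly_all_0_iff_0 by blast
    then show ?thesis
      using e by (auto simp: poly_evals_def)
  qed
  obtain w :: "'a \<Rightarrow> nat" where w: "\<And>a b. a \<in> S \<Longrightarrow> b \<in> S \<Longrightarrow> a \<noteq> 0 \<Longrightarrow> b \<noteq> 0 \<Longrightarrow> w (a * b) = w a + w b"
    "\<And>a. a \<in> S \<Longrightarrow> a \<noteq> 0 \<Longrightarrow> w a = 0 \<Longrightarrow> unit_in S a"
    using factor_count by auto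
  let ?w = "\<lambda>p. degree p + w (lead_coeff p)"
  have add: "?w (a * b) = ?w a + ?w b" if "a \<in> polys S - {0}" "b \<in> polys S - {0}" for a b
    using that by (simp add: degree_mult_eq coeff_mult_degree_sum polys_def w(1))
  have unit: "unit_in (polys S) a" if a: "a \<in> polys S - {0}" "?w a = 0" for a
  proof -
    have "degree a = 0"
      using a(2) by simp
    then obtain c where "a = [:c:]"
      by (rule degree_eq_zeroE)
    moreover from this have "c \<in> S" "c \<noteq> 0" "w c = 0"
      using a by (auto simp: polys_def dest: spec[of _ 0])
    ultimately show ?thesis
      using w(2) unit_in_polys[OF subring] by blast
  qed
  show "\<exists>w :: 'a poly \<Rightarrow> nat. (\<forall>a \<in> polys S - {0}. \<forall>b \<in> polys S - {0}. w (a * b) = w a + w b) \<and>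
      (\<forall>a \<in> polys S - {0}. w a = 0 \<longrightarrow> unit_in (polys S) a)"
    by (intro exI[of _ ?w] conjI ballI impI add unit)
qed

text \<open>
  Elimination for reducible \<open>f\<close>: constants in \<open>(p, h)\<close> and in \<open>(a, h)\<close> multiply to one in \<open>(p a, h)\<close>, so the
  claim passes from the irreducible factors to the product.
\<close>

lemma eliminate_variable_coprime:
  assumes "f \<in> polys S" "f \<noteq> 0" "h \<in> polys S"
    and "\<And>g. irreducible_in (polys S) g \<Longrightarrow> dvd_in (polys S) g f \<Longrightarrow> degree g > 0 \<Longrightarrow>
      \<not> dvd_in (polys S) g h"
  shows "\<exists>r u v. r \<in> S \<and> r \<noteq> 0 \<and> u \<in> polys S \<and> v \<in> polys S \<and> [:r:] = u * f + v * h"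
proof -
  interpret P: nullstellensatz_ring "polys S" "poly_evals E"
    by (rule nullstellensatz_ring_poly)
  note add = subring_add[OF subring_poly] and mult = subring_mult[OF subring_poly]
    and zero = subring_0[OF subring_poly] and one = subring_1[OF subring_poly]
  from assms show ?thesis
  proof (induction rule: P.factor_induct)
    case (unit u)
    then obtain v where "v \<in> polys S" "u * v = 1"
      by (auto simp: unit_in_def)
    then show ?case
      using subring_1[OF subring] zero
      by (intro exI[of _ 1] exI[of _ v] exI[of _ 0]) (auto simp: one_pCons mult.commute)
  next
    case (irreducible p a)
    have p: "p \<in> polys S" "p \<noteq> 0"
      using irreducible by (auto simp: irreducible_in_def)
    have "dvd_in (polys S) g (p * a)" if "dvd_in (polys S) g a" for g
      using dvd_in_mult[OF subring_poly that p(1)] by (simp add: mult.commute)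
    then obtain r u v where r: "r \<in> S" "r \<noteq> 0" "u \<in> polys S" "v \<in> polys S" "[:r:] = u * a + v * h"
      using irreducible.IH irreducible.prems by meson
    have "\<exists>s u v. s \<in> S \<and> s \<noteq> 0 \<and> u \<in> polys S \<and> v \<in> polys S \<and> [:s:] = u * p + v * h"
    proof (cases "degree p = 0")
      case True
      then obtain c where "p = [:c:]"
        by (metis degree_eq_zeroE)
      then show ?thesis
        using p zero one
        by (intro exI[of _ c] exI[of _ 1] exI[of _ 0]) (auto simp: polys_def dest: spec[of _ 0])
    next
      case False
      moreover have "dvd_in (polys S) p (p * a)"
        using irreducible by (auto simp: dvd_in_def)
      ultimately show ?thesis
        using irreducible eliminate_variable by simp
    qed
    then obtain s u' v' where s: "s \<in> S" "s \<noteq> 0" "u' \<in> polys S" "v' \<in> polys S" "[:s:] = u' * p + v' * h"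
      by blast
    have "[:r * s:] = [:r:] * [:s:]"
      by simp
    also have "\<dots> = (u * a + v * h) * (u' * p + v' * h)"
      using r s by simp
    also have "\<dots> = u * u' * (p * a) + (u * a * v' + v * u' * p + v * v' * h) * h"
      by (simp add: algebra_simps)
    finally show ?case
      using r s p irreducible subring_mult[OF subring]
      by (intro exI[of _ "r * s"] exI[of _ "u * u'"] exI[of _ "u * a * v' + v * u' * p + v * v' * h"])
        (auto intro!: add mult)
  qed
qed

text \<open>
  The discriminant argument: a polynomial without repeated factors has simple roots at a generic point. If no
  irreducible \<open>g\<close> of positive degree divides both \<open>f\<close> and its derivative, then a nonzero constant \<open>r\<close> in the ideal
  they generate vanishes wherever they have a common root, that is, everywhere.
\<close>

lemma square_factor:
  assumes char0: "\<And>k. of_nat (Suc k) \<noteq> (0 :: 'a)"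
    and f: "f \<in> polys S" "f \<noteq> 0"
    and roots: "\<And>e. e \<in> E \<Longrightarrow> \<exists>t. poly (map_poly e f) t = 0 \<and> poly (map_poly e (pderiv f)) t = 0"
  shows "\<exists>g. irreducible_in (polys S) g \<and> dvd_in (polys S) (g * g) f"
proof (rule ccontr)
  assume contr: "\<not> ?thesis"
  have f': "pderiv f \<in> polys S"
    by (rule pderiv_in_polys[OF subring f(1)])
  have "\<not> dvd_in (polys S) g (pderiv f)"
    if g: "irreducible_in (polys S) g" "dvd_in (polys S) g f" "degree g > 0" for g
  proof
    assume dvd: "dvd_in (polys S) g (pderiv f)"
    have gS: "g \<in> polys S"
      using g by (simp add: irreducible_in_def)
    then have g'S: "pderiv g \<in> polys S"
      by (rule pderiv_in_polys[OF subring])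
    obtain h where h: "h \<in> polys S" "f = g * h"
      using g by (auto simp: dvd_in_def)
    \<comment> \<open>As \<open>f\' = g h\' + h g\'\<close>, the prime \<open>g\<close> divides \<open>h\<close> or \<open>g\'\<close>.\<close>
    have "dvd_in (polys S) g (g * pderiv h)"
      using pderiv_in_polys[OF subring h(1)] by (auto simp: dvd_in_def)
    then have "dvd_in (polys S) g (pderiv f - g * pderiv h)"
      using dvd by (intro dvd_in_diff subring_poly)
    moreover have "pderiv f - g * pderiv h = h * pderiv g"
      by (simp add: h(2) pderiv_mult)
    ultimately have "dvd_in (polys S) g h \<or> dvd_in (polys S) g (pderiv g)"
      using prime_poly[OF g(1) h(1) g'S] by simp
    moreover have "\<not> dvd_in (polys S) g h"
    proof
      assume "dvd_in (polys S) g h"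
      then have "dvd_in (polys S) (g * g) f"
        by (auto simp: dvd_in_def h(2) mult.assoc)
      then show False
        using contr g by blast
    qed
    moreover have "\<not> dvd_in (polys S) g (pderiv g)"
    proof
      assume "dvd_in (polys S) g (pderiv g)"
      then have d: "g dvd pderiv g"
        by (auto simp: dvd_in_def)
      have "coeff (pderiv g) (degree g - 1) = of_nat (degree g) * lead_coeff g"
        using g(3) by (simp add: coeff_pderiv)
      moreover have "of_nat (degree g) \<noteq> (0 :: 'a)"
        using char0[of "degree g - 1"] g(3) by simp
      ultimately have "pderiv g \<noteq> 0"
        using g(3) by (metis degree_0 leading_coeff_0_iff less_irrefl mult_eq_0_iff coeff_0)
      then have "degree g \<le> degree (pderiv g)"
        using d by (rule dvd_imp_degree_le[rotated])
      moreover have "degree (pderiv g) \<le> degree g - 1"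
        by (rule degree_le) (auto simp: coeff_pderiv coeff_eq_0)
      ultimately show False
        using g(3) by simp
    qed
    ultimately show False
      by blast
  qed
  then obtain r u v where r: "r \<in> S" "r \<noteq> 0" "[:r:] = u * f + v * pderiv f"
    using eliminate_variable_coprime[OF f f'] by blast
  then obtain e where e: "e \<in> E" "e r \<noteq> 0"
    using separating by blast
  then obtain t where t: "poly (map_poly e f) t = 0" "poly (map_poly e (pderiv f)) t = 0"
    using roots by blast
  note he = hom[OF e(1)] and ht = hom_poly_map[OF hom[OF e(1)], of t]
  have "poly (map_poly e [:r:]) t = 0"
    unfolding r(3) using t hom_add[OF ht] hom_mult[OF ht] by simp
  then show False
    using e by (simp add: map_poly_pCons hom_0[OF he])
qed

end


section \<open>Polynomials in finitely many variables\<close>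

definition Var :: "nat \<Rightarrow> cpoly" where
  "Var i = Poly_Mapping.single (Poly_Mapping.single i 1) 1"

definition Const :: "complex \<Rightarrow> cpoly" where
  "Const c = Poly_Mapping.single 0 c"

definition eval_monomial :: "(nat \<Rightarrow> 'b) \<Rightarrow> (nat \<Rightarrow>\<^sub>0 nat) \<Rightarrow> 'b::comm_ring_1" where
  "eval_monomial x m = (\<Prod>i \<in> Poly_Mapping.keys m. x i ^ Poly_Mapping.lookup m i)"

lemma eval_monomial_superset:
  assumes "finite A" "Poly_Mapping.keys m \<subseteq> A"
  shows "eval_monomial x m = (\<Prod>i \<in> A. x i ^ Poly_Mapping.lookup m i)"
  unfolding eval_monomial_def
  by (rule prod.mono_neutral_left) (use assms in \<open>auto simp: in_keys_iff\<close>)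

lemma eval_monomial_add: "eval_monomial x (m + m') = eval_monomial x m * eval_monomial x m'"
proof -
  let ?A = "Poly_Mapping.keys m \<union> Poly_Mapping.keys m'"
  have "Poly_Mapping.keys (m + m') \<subseteq> ?A" by (rule keys_add)
  then show ?thesis
    by (simp add: eval_monomial_superset[of ?A] lookup_add power_add prod.distrib)
qed

lemma eval_monomial_0 [simp]: "eval_monomial x 0 = 1"
  by (simp add: eval_monomial_def)

lemma mp_eval_superset:
  assumes "finite A" "Poly_Mapping.keys F \<subseteq> A" "\<phi> 0 = 0"
  shows "mp_eval \<phi> x F = (\<Sum>m \<in> A. \<phi> (Poly_Mapping.lookup F m) * eval_monomial x m)"
  unfolding mp_eval_def eval_monomial_def
  by (rule sum.mono_neutral_left) (use assms in \<open>auto simp: in_keys_iff\<close>)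

lemma mp_eval_add:
  assumes "unital_hom \<phi>"
  shows "mp_eval \<phi> x (F + G) = mp_eval \<phi> x F + mp_eval \<phi> x G"
proof -
  let ?A = "Poly_Mapping.keys F \<union> Poly_Mapping.keys G"
  have "Poly_Mapping.keys (F + G) \<subseteq> ?A" by (rule keys_add)
  then show ?thesis
    by (simp add: mp_eval_superset[of ?A _ \<phi>] hom_0[OF assms] lookup_add hom_add[OF assms]
        algebra_simps sum.distrib)
qed

lemma mp_eval_0 [simp]: "mp_eval \<phi> x 0 = 0"
  by (simp add: mp_eval_def)

lemma mp_eval_sum:
  assumes "unital_hom \<phi>"
  shows "mp_eval \<phi> x (sum f A) = (\<Sum>a \<in> A. mp_eval \<phi> x (f a))"
  by (induction A rule: infinite_finite_induct) (auto simp: mp_eval_add[OF assms])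

lemma mp_eval_single:
  assumes "unital_hom \<phi>"
  shows "mp_eval \<phi> x (Poly_Mapping.single m c) = \<phi> c * eval_monomial x m"
  by (simp add: mp_eval_superset[of "{m}"] hom_0[OF assms])

lemma mp_eval_mult:
  assumes "unital_hom \<phi>"
  shows "mp_eval \<phi> x (F * G) = mp_eval \<phi> x F * mp_eval \<phi> x G"
  unfolding mult_eq_sum_single mp_eval_sum[OF assms] mp_eval_single[OF assms] eval_monomial_add
    hom_mult[OF assms]
  by (simp add: mp_eval_def sum_product ac_simps flip: eval_monomial_def)

lemma hom_Const: "unital_hom Const"
  unfolding unital_hom_def Const_def by (simp add: single_add mult_single)

lemma hom_mp_eval: "unital_hom \<phi> \<Longrightarrow> unital_hom (mp_eval \<phi> x)"
  unfolding unital_hom_def[of "mp_eval \<phi> x"]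
  using mp_eval_single[of \<phi> x 0 1]
  by (simp add: mp_eval_add mp_eval_mult hom_1)

lemma mp_eval_Const: "unital_hom \<phi> \<Longrightarrow> mp_eval \<phi> x (Const c) = \<phi> c"
  by (simp add: Const_def mp_eval_single)

lemma mp_eval_Var: "unital_hom \<phi> \<Longrightarrow> mp_eval \<phi> x (Var i) = x i"
  by (simp add: Var_def mp_eval_single eval_monomial_def hom_1)

lemma hom_id: "unital_hom (\<lambda>c. c)"
  by (simp add: unital_hom_def)

lemma exponent_sum_single:
  "(\<Sum>i \<in> Poly_Mapping.keys m. Poly_Mapping.single i (Poly_Mapping.lookup m i)) = (m :: nat \<Rightarrow>\<^sub>0 nat)"
  by (rule poly_mapping_eqI)
     (auto simp: lookup_sum lookup_single when_def in_keys_iff sum.delta)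

lemma eval_monomial_Var: "eval_monomial Var m = Poly_Mapping.single m 1"
proof -
  have pow: "Var i ^ k = Poly_Mapping.single (Poly_Mapping.single i k) 1" for i k
    by (induction k) (simp_all add: Var_def mult_single flip: single_add)
  have "(\<Prod>i \<in> A. Poly_Mapping.single (f i) (1 :: complex)) = Poly_Mapping.single (sum f A) 1"
    if "finite A" for A :: "nat set" and f :: "nat \<Rightarrow> nat \<Rightarrow>\<^sub>0 nat"
    using that by induction (simp_all add: mult_single)
  from this[of "Poly_Mapping.keys m" "\<lambda>i. Poly_Mapping.single i (Poly_Mapping.lookup m i)"]
  show ?thesis
    by (simp add: eval_monomial_def pow exponent_sum_single)
qed

lemma single_eq_Const_mult: "Poly_Mapping.single m c = Const c * eval_monomial Var m"
  by (simp add: eval_monomial_Var Const_def mult_single)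

text \<open>
  A homomorphism is determined by its values on constants and variables. Most identities between
  substitutions below are checked in this way.
\<close>

lemma hom_eq_mp_eval:
  assumes "unital_hom h"
  shows "h F = mp_eval (\<lambda>c. h (Const c)) (\<lambda>i. h (Var i)) F"
proof -
  have "h F = h (\<Sum>m \<in> Poly_Mapping.keys F. Poly_Mapping.single m (Poly_Mapping.lookup F m))"
    by (simp only: poly_mapping_sum_single)
  then show ?thesis
    by (simp add: single_eq_Const_mult hom_sum[OF assms] hom_mult[OF assms] eval_monomial_def
        hom_prod[OF assms] hom_power[OF assms] mp_eval_def)
qed

lemma hom_cpoly_ext:
  assumes "unital_hom h" "unital_hom h'" "\<And>c. h (Const c) = h' (Const c)" "\<And>i. h (Var i) = h' (Var i)"
  shows "h F = h' F"
proof -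
  have "h F = mp_eval (\<lambda>c. h (Const c)) (\<lambda>i. h (Var i)) F"
    by (rule hom_eq_mp_eval[OF assms(1)])
  also have "\<dots> = h' F"
    unfolding assms(3,4) by (rule hom_eq_mp_eval[OF assms(2), symmetric])
  finally show ?thesis .
qed

lemma hom_mp_eval_comp:
  assumes h: "unital_hom h" and \<phi>: "unital_hom \<phi>"
  shows "h (mp_eval \<phi> x F) = mp_eval (\<lambda>c. h (\<phi> c)) (\<lambda>i. h (x i)) F"
proof (rule hom_cpoly_ext[where h = "\<lambda>F. h (mp_eval \<phi> x F)"])
  note h\<phi> = hom_comp[OF h \<phi>]
  show "unital_hom (\<lambda>F. h (mp_eval \<phi> x F))"
    by (rule hom_comp[OF h hom_mp_eval[OF \<phi>]])
  show "unital_hom (mp_eval (\<lambda>c. h (\<phi> c)) (\<lambda>i. h (x i)))"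
    by (rule hom_mp_eval[OF h\<phi>])
  show "h (mp_eval \<phi> x (Const c)) = mp_eval (\<lambda>c. h (\<phi> c)) (\<lambda>i. h (x i)) (Const c)" for c
    by (simp add: mp_eval_Const[OF \<phi>] mp_eval_Const[OF h\<phi>])
  show "h (mp_eval \<phi> x (Var i)) = mp_eval (\<lambda>c. h (\<phi> c)) (\<lambda>i. h (x i)) (Var i)" for i
    by (simp add: mp_eval_Var[OF \<phi>] mp_eval_Var[OF h\<phi>])
qed

lemma hom_poly_ext:
  assumes h: "unital_hom h" and h': "unital_hom h'"
    and eq: "\<And>a. h [:a:] = h' [:a:]" "h [:0, 1:] = h' [:0, 1:]"
  shows "h q = h' q"
proof (induction q)
  case (pCons a q)
  have "pCons a q = [:a:] + [:0, 1:] * q"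
    by simp
  then show ?case
    using pCons eq by (simp only: hom_add[OF h] hom_mult[OF h] hom_add[OF h'] hom_mult[OF h'])
qed (simp add: hom_0[OF h] hom_0[OF h'])

definition pring :: "nat \<Rightarrow> cpoly set" where
  "pring k = {F. \<forall>m \<in> Poly_Mapping.keys F. Poly_Mapping.keys m \<subseteq> {..<k}}"

lemma subring_pring: "subring (pring k)"
  unfolding subring_def
proof (intro conjI ballI)
  show "1 \<in> pring k"
    by (auto simp: pring_def)
  fix F G assume FG: "F \<in> pring k" "G \<in> pring k"
  show "F - G \<in> pring k"
    using FG keys_diff[of F G] by (auto simp: pring_def)
  show "F * G \<in> pring k"
    unfolding pring_def
  proof (intro CollectI ballI)
    fix m assume "m \<in> Poly_Mapping.keys (F * G)"
    then obtain a b where "a \<in> Poly_Mapping.keys F" "b \<in> Poly_Mapping.keys G" "m = a + b"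
      using keys_mult[of F G] by blast
    then show "Poly_Mapping.keys m \<subseteq> {..<k}"
      using FG keys_add[of a b] by (fastforce simp: pring_def)
  qed
qed

lemma Const_in_pring: "Const c \<in> pring k"
  by (auto simp: Const_def pring_def)

lemma Var_in_pring: "i < k \<Longrightarrow> Var i \<in> pring k"
  by (auto simp: Var_def pring_def)

lemma mp_eval_in_subring:
  assumes "subring T" "\<And>c. \<phi> c \<in> T" "\<And>i. i < k \<Longrightarrow> x i \<in> T" "F \<in> pring k"
  shows "mp_eval \<phi> x F \<in> T"
  unfolding mp_eval_def using assms(4)
  by (auto simp: pring_def intro!: subring_sum subring_mult subring_prod subring_power assms)

lemma pring_0: "F \<in> pring 0 \<longleftrightarrow> (\<exists>c. F = Const c)"
proof
  assume "F \<in> pring 0"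
  then have "Poly_Mapping.keys F \<subseteq> {0}"
    by (auto simp: pring_def)
  then have "F = Const (Poly_Mapping.lookup F 0)"
    by (intro poly_mapping_eqI) (auto simp: Const_def lookup_single when_def in_keys_iff)
  then show "\<exists>c. F = Const c" ..
qed (auto simp: Const_in_pring)


section \<open>Splitting off a variable\<close>

text \<open>
  The coordinate change \<open>x\<^sub>0 = t\<close>, \<open>x\<^sub>j\<^sub>+\<^sub>1 = y\<^sub>j + t p\<^sub>j\<close> views a polynomial in \<open>k + 1\<close> variables as a
  polynomial in \<open>t\<close> over the ring in \<open>k\<close> variables \<open>y\<close>, that is, as a function on the lines in direction \<open>(1, p)\<close>. The
  induction on the number of variables uses \<open>p = 0\<close>. Tangency to the lines through a point
  uses the coordinates of that point as \<open>p\<close>. The inverse map is \<open>join_var p\<close>.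
\<close>

definition split_var :: "(nat \<Rightarrow> complex) \<Rightarrow> cpoly \<Rightarrow> cpoly poly" where
  "split_var p = mp_eval (\<lambda>c. [:Const c:]) (case_nat [:0, 1:] (\<lambda>j. [:Var j, Const (p j):]))"

definition shear :: "(nat \<Rightarrow> complex) \<Rightarrow> cpoly \<Rightarrow> cpoly" where
  "shear p = mp_eval Const (\<lambda>j. Var (Suc j) - Const (p j) * Var 0)"

definition join_var :: "(nat \<Rightarrow> complex) \<Rightarrow> cpoly poly \<Rightarrow> cpoly" where
  "join_var p q = poly (map_poly (shear p) q) (Var 0)"

lemma hom_split_var: "unital_hom (split_var p)"
  unfolding split_var_def by (intro hom_mp_eval hom_comp[OF hom_pCons_0 hom_Const])

lemma hom_shear: "unital_hom (shear p)"
  unfolding shear_def by (intro hom_mp_eval hom_Const)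

lemma hom_join_var: "unital_hom (join_var p)"
  unfolding join_var_def by (intro hom_poly_map hom_shear)

lemma split_var_Const: "split_var p (Const c) = [:Const c:]"
  by (simp add: split_var_def mp_eval_Const hom_comp[OF hom_pCons_0 hom_Const])

lemma split_var_Var: "split_var p (Var i) = case_nat [:0, 1:] (\<lambda>j. [:Var j, Const (p j):]) i"
  by (simp add: split_var_def mp_eval_Var hom_comp[OF hom_pCons_0 hom_Const])

lemma shear_Const: "shear p (Const c) = Const c"
  by (simp add: shear_def mp_eval_Const hom_Const)

lemma shear_Var: "shear p (Var j) = Var (Suc j) - Const (p j) * Var 0"
  by (simp add: shear_def mp_eval_Var hom_Const)

lemma join_var_pCons: "join_var p (pCons a q) = shear p a + Var 0 * join_var p q"
  by (simp add: join_var_def map_poly_pCons hom_0[OF hom_shear])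

lemma join_var_0 [simp]: "join_var p 0 = 0"
  by (simp add: join_var_def)

lemma join_split_var: "join_var p (split_var p F) = F"
proof (rule hom_cpoly_ext[where h = "\<lambda>F. join_var p (split_var p F)" and h' = "\<lambda>F. F"])
  show "unital_hom (\<lambda>F. join_var p (split_var p F))"
    by (rule hom_comp[OF hom_join_var hom_split_var])
  show "join_var p (split_var p (Const c)) = Const c" for c
    by (simp add: split_var_Const join_var_pCons shear_Const)
  show "join_var p (split_var p (Var i)) = Var i" for i
    using hom_1[OF hom_shear[of p]]
    by (cases i) (simp_all add: split_var_Var join_var_pCons shear_Const shear_Var
        hom_0[OF hom_shear] algebra_simps)
qed (rule hom_id)

lemma split_var_shear: "split_var p (shear p a) = [:a:]"
proof (rule hom_cpoly_ext[where h = "\<lambda>a. split_var p (shear p a)" and h' = "\<lambda>a. [:a:]"])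
  show "unital_hom (\<lambda>a. split_var p (shear p a))"
    by (rule hom_comp[OF hom_split_var hom_shear])
  show "split_var p (shear p (Const c)) = [:Const c:]" for c
    by (simp add: split_var_Const shear_Const)
  show "split_var p (shear p (Var i)) = [:Var i:]" for i
    by (simp add: split_var_Const split_var_Var shear_Var hom_diff[OF hom_split_var]
        hom_mult[OF hom_split_var])
qed (rule hom_pCons_0)

lemma split_join_var: "split_var p (join_var p q) = q"
proof (rule hom_poly_ext[where h = "\<lambda>q. split_var p (join_var p q)" and h' = "\<lambda>q. q"])
  show "unital_hom (\<lambda>q. split_var p (join_var p q))"
    by (rule hom_comp[OF hom_split_var hom_join_var])
  show "split_var p (join_var p [:a:]) = [:a:]" for a
    by (simp add: join_var_pCons split_var_shear)
  show "split_var p (join_var p [:0, 1:]) = [:0, 1:]"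
    by (simp add: join_var_pCons split_var_Var hom_0[OF hom_shear] hom_1[OF hom_shear])
qed (rule hom_id)

lemma split_var_in_polys: "F \<in> pring (Suc k) \<Longrightarrow> split_var p F \<in> polys (pring k)"
  unfolding split_var_def
proof (rule mp_eval_in_subring[OF subring_polys[OF subring_pring]])
  show "[:Const c:] \<in> polys (pring k)" for c
    by (intro const_in_polys subring_pring Const_in_pring)
  show "case_nat [:0, 1:] (\<lambda>j. [:Var j, Const (p j):]) i \<in> polys (pring k)" if "i < Suc k" for i
    using that Var_in_pring Const_in_pring subring_0[OF subring_pring] subring_1[OF subring_pring]
    by (auto simp: polys_def coeff_pCons split: nat.splits)
qed

lemma join_var_in_pring:
  assumes "q \<in> polys (pring k)"
  shows "join_var p q \<in> pring (Suc k)"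
proof -
  have "shear p a \<in> pring (Suc k)" if "a \<in> pring k" for a
    unfolding shear_def using that
    by (intro mp_eval_in_subring[where k = k] subring_diff subring_mult subring_pring Const_in_pring
        Var_in_pring) auto
  then have "coeff (map_poly (shear p) q) i \<in> pring (Suc k)" for i
    using assms by (auto simp: coeff_map_poly hom_0[OF hom_shear] polys_def)
  then show ?thesis
    unfolding join_var_def poly_altdef
    by (intro subring_sum subring_mult subring_power subring_pring Var_in_pring) auto
qed

lemma split_var_in_polys_iff: "split_var p F \<in> polys (pring k) \<longleftrightarrow> F \<in> pring (Suc k)"
  using split_var_in_polys join_var_in_pring join_split_var by metis

definition point_evals :: "(cpoly \<Rightarrow> complex) set" where
  "point_evals = range (mp_eval (\<lambda>c. c))"

lemma eval_split_var:
  "poly (map_poly (mp_eval (\<lambda>c. c) y) (split_var p F)) t =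
    mp_eval (\<lambda>c. c) (case_nat t (\<lambda>j. y j + t * p j)) F"
proof (rule hom_cpoly_ext[where h = "\<lambda>F. poly (map_poly (mp_eval (\<lambda>c. c) y) (split_var p F)) t"])
  note he = hom_mp_eval[OF hom_id, of y]
  show "unital_hom (\<lambda>F. poly (map_poly (mp_eval (\<lambda>c. c) y) (split_var p F)) t)"
    by (rule hom_comp[OF hom_poly_map[OF he] hom_split_var])
  show "unital_hom (mp_eval (\<lambda>c. c) (case_nat t (\<lambda>j. y j + t * p j)))"
    by (rule hom_mp_eval[OF hom_id])
  show "poly (map_poly (mp_eval (\<lambda>c. c) y) (split_var p (Const c))) t =
      mp_eval (\<lambda>c. c) (case_nat t (\<lambda>j. y j + t * p j)) (Const c)" for c
    by (simp add: split_var_Const map_poly_pCons hom_0[OF he] mp_eval_Const[OF hom_id])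
  show "poly (map_poly (mp_eval (\<lambda>c. c) y) (split_var p (Var i))) t =
      mp_eval (\<lambda>c. c) (case_nat t (\<lambda>j. y j + t * p j)) (Var i)" for i
    by (cases i) (simp_all add: split_var_Var map_poly_pCons hom_0[OF he] hom_1[OF he]
        mp_eval_Const[OF hom_id] mp_eval_Var[OF hom_id])
qed

lemma point_evals_split_var:
  "{\<lambda>F. e (split_var (\<lambda>_. 0) F) | e. e \<in> poly_evals point_evals} = point_evals"
proof (intro equalityI subsetI)
  have eq: "(\<lambda>F. poly (map_poly (mp_eval (\<lambda>c. c) y) (split_var (\<lambda>_. 0) F)) t) =
      mp_eval (\<lambda>c. c) (case_nat t y)" for y t
    by (simp add: fun_eq_iff eval_split_var)
  {
    fix e assume "e \<in> {\<lambda>F. e (split_var (\<lambda>_. 0) F) | e. e \<in> poly_evals point_evals}"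
    then obtain y t where "e = (\<lambda>F. poly (map_poly (mp_eval (\<lambda>c. c) y) (split_var (\<lambda>_. 0) F)) t)"
      by (auto simp: poly_evals_def point_evals_def)
    then show "e \<in> point_evals"
      unfolding eq point_evals_def by simp
  next
    fix e assume "e \<in> point_evals"
    then obtain z where "e = mp_eval (\<lambda>c. c) z"
      by (auto simp: point_evals_def)
    moreover have "case_nat (z 0) (\<lambda>j. z (Suc j)) = z"
      by (auto simp: fun_eq_iff split: nat.splits)
    ultimately have "e = (\<lambda>F. (\<lambda>p. poly (map_poly (mp_eval (\<lambda>c. c) (\<lambda>j. z (Suc j))) p) (z 0))
        (split_var (\<lambda>_. 0) F))"
      using eq[of "\<lambda>j. z (Suc j)" "z 0"] by simp
    moreover have "(\<lambda>p. poly (map_poly (mp_eval (\<lambda>c. c) (\<lambda>j. z (Suc j))) p) (z 0))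
        \<in> poly_evals point_evals"
      unfolding poly_evals_def point_evals_def by blast
    ultimately show "e \<in> {\<lambda>F. e (split_var (\<lambda>_. 0) F) | e. e \<in> poly_evals point_evals}"
      by (intro CollectI exI conjI)
  }
qed

text \<open>
  An isomorphism of the ambient rings that restricts to one of the subrings carries over every notion relative
  to these subrings.
\<close>

locale subring_iso =
  fixes \<phi> :: "'a::idom \<Rightarrow> 'b::idom" and \<psi> :: "'b \<Rightarrow> 'a" and S :: "'a set" and T :: "'b set"
  assumes hom: "unital_hom \<phi>" and inverse: "\<psi> (\<phi> a) = a" "\<phi> (\<psi> b) = b"
    and in_iff: "\<phi> a \<in> T \<longleftrightarrow> a \<in> S"
begin

lemma inj: "\<phi> a = \<phi> b \<longleftrightarrow> a = b"
  using inverse by metis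

lemma ball_iff: "(\<forall>b \<in> T. P b) \<longleftrightarrow> (\<forall>a \<in> S. P (\<phi> a))"
  and bex_iff: "(\<exists>b \<in> T. P b) \<longleftrightarrow> (\<exists>a \<in> S. P (\<phi> a))"
  using in_iff inverse by metis+

lemma mult_eq_iff: "\<phi> a = \<phi> b * \<phi> c \<longleftrightarrow> a = b * c" "\<phi> b * \<phi> c = \<phi> a \<longleftrightarrow> b * c = a"
  and eq_0_iff: "\<phi> a = 0 \<longleftrightarrow> a = 0" and eq_1_iff: "\<phi> b * \<phi> c = 1 \<longleftrightarrow> b * c = 1"
  using hom_mult[OF hom] hom_1[OF hom] hom_0[OF hom] inj by metis+

lemma dvd_in_iff: "dvd_in T (\<phi> a) (\<phi> b) \<longleftrightarrow> dvd_in S a b"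
  by (simp add: dvd_in_def bex_iff mult_eq_iff)

lemma unit_in_iff: "unit_in T (\<phi> a) \<longleftrightarrow> unit_in S a"
  by (simp add: unit_in_def bex_iff eq_1_iff in_iff)

lemma irreducible_in_iff: "irreducible_in T (\<phi> a) \<longleftrightarrow> irreducible_in S a"
  by (simp add: irreducible_in_def ball_iff mult_eq_iff unit_in_iff in_iff eq_0_iff)

lemma nullstellensatz_ring_pullback:
  assumes "nullstellensatz_ring T E"
  shows "nullstellensatz_ring S {\<lambda>a. e (\<phi> a) | e. e \<in> E}"
proof -
  interpret T: nullstellensatz_ring T E by fact
  show ?thesis
  proof
    show "subring S"
      using T.subring unfolding subring_def by (metis hom hom_1 hom_diff hom_mult in_iff)
    obtain w :: "'b \<Rightarrow> nat" where w: "\<forall>a \<in> T - {0}. \<forall>b \<in> T - {0}. w (a * b) = w a + w b"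
      "\<forall>a \<in> T - {0}. w a = 0 \<longrightarrow> unit_in T a"
      by (rule exE[OF T.factor_count]) (elim conjE, rule that)
    have "\<forall>a \<in> S - {0}. \<forall>b \<in> S - {0}. w (\<phi> (a * b)) = w (\<phi> a) + w (\<phi> b)"
      using w(1) by (simp add: hom_mult[OF hom] in_iff eq_0_iff)
    moreover have "\<forall>a \<in> S - {0}. w (\<phi> a) = 0 \<longrightarrow> unit_in S a"
      using w(2) by (metis Diff_iff eq_0_iff in_iff insert_iff empty_iff unit_in_iff)
    ultimately show "\<exists>w :: 'a \<Rightarrow> nat. (\<forall>a \<in> S - {0}. \<forall>b \<in> S - {0}. w (a * b) = w a + w b) \<and>
        (\<forall>a \<in> S - {0}. w a = 0 \<longrightarrow> unit_in S a)"
      by (intro exI[of _ "\<lambda>a. w (\<phi> a)"] conjI)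
    show "dvd_in S p a \<or> dvd_in S p b"
      if "irreducible_in S p" "a \<in> S" "b \<in> S" "dvd_in S p (a * b)" for p a b
      using T.prime[of "\<phi> p" "\<phi> a" "\<phi> b"] that
      by (simp add: irreducible_in_iff in_iff dvd_in_iff flip: hom_mult[OF hom])
    show "unital_hom e" if e: "e \<in> {\<lambda>a. e (\<phi> a) | e. e \<in> E}" for e
    proof -
      obtain e' where "e' \<in> E" "e = (\<lambda>a. e' (\<phi> a))"
        using e by auto
      then show ?thesis
        using hom_comp[OF T.hom hom] by simp
    qed
    show "\<exists>e \<in> {\<lambda>a. e (\<phi> a) | e. e \<in> E}. e a \<noteq> 0" if "a \<in> S" "a \<noteq> 0" for a
      using T.separating[of "\<phi> a"] that by (auto simp: in_iff eq_0_iff)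
    show "dvd_in S p h"
      if "irreducible_in S p" "h \<in> S" "\<And>e. e \<in> {\<lambda>a. e (\<phi> a) | e. e \<in> E} \<Longrightarrow> e p = 0 \<Longrightarrow> e h = 0" for p h
    proof -
      have "e (\<phi> h) = 0" if "e \<in> E" "e (\<phi> p) = 0" for e
        using \<open>\<And>e. e \<in> {\<lambda>a. e (\<phi> a) | e. e \<in> E} \<Longrightarrow> e p = 0 \<Longrightarrow> e h = 0\<close>[of "\<lambda>a. e (\<phi> a)"] that
        by blast
      then show ?thesis
        using T.nullstellensatz[of "\<phi> p" "\<phi> h"] that(1,2) by (simp add: irreducible_in_iff in_iff dvd_in_iff)
    qed
  qed
qed

end

lemma subring_iso_split_var:
  "subring_iso (split_var p) (join_var p) (pring (Suc k)) (polys (pring k))"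
  by unfold_locales (rule hom_split_var join_split_var split_join_var split_var_in_polys_iff)+

lemma unit_in_pring_Const:
  assumes "c \<noteq> 0"
  shows "unit_in (pring k) (Const c)"
proof -
  have "Const c * Const (inverse c) = 1"
    using assms by (simp add: hom_1[OF hom_Const] flip: hom_mult[OF hom_Const])
  then show ?thesis
    using Const_in_pring by (auto simp: unit_in_def)
qed

theorem nullstellensatz_ring_pring: "nullstellensatz_ring (pring k) point_evals"
proof (induction k)
  case 0
  have unit: "unit_in (pring 0) a" if "a \<in> pring 0" "a \<noteq> 0" for a
    using that unit_in_pring_Const hom_0[OF hom_Const] by (metis pring_0)
  then have irr: "\<not> irreducible_in (pring 0) p" for p
    by (auto simp: irreducible_in_def)
  show ?case
  proof
    show "\<exists>w :: cpoly \<Rightarrow> nat. (\<forall>a \<in> pring 0 - {0}. \<forall>b \<in> pring 0 - {0}. w (a * b) = w a + w b) \<and>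
        (\<forall>a \<in> pring 0 - {0}. w a = 0 \<longrightarrow> unit_in (pring 0) a)"
      using unit by (intro exI[of _ "\<lambda>_. 0"]) auto
    show "unital_hom e" if "e \<in> point_evals" for e
      using that hom_mp_eval[OF hom_id] by (auto simp: point_evals_def)
    show "\<exists>e \<in> point_evals. e a \<noteq> 0" if a: "a \<in> pring 0" "a \<noteq> 0" for a
    proof -
      obtain c where c: "a = Const c"
        using a pring_0 by blast
      then have "mp_eval (\<lambda>c. c) (\<lambda>_. 0) a \<noteq> 0"
        using a by (auto simp: mp_eval_Const[OF hom_id] hom_0[OF hom_Const])
      then show ?thesis
        unfolding point_evals_def by blast
    qed
  qed (use irr subring_pring in auto)
next
  case (Suc k)
  interpret nullstellensatz_ring "pring k" point_evals by fact
  interpret subring_iso "split_var (\<lambda>_. 0)" "join_var (\<lambda>_. 0)" "pring (Suc k)" "polys (pring k)"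
    by (rule subring_iso_split_var)
  show ?case
    using nullstellensatz_ring_pullback[OF nullstellensatz_ring_poly]
    unfolding point_evals_split_var .
qed


section \<open>Forms\<close>

definition total_degree :: "(nat \<Rightarrow>\<^sub>0 nat) \<Rightarrow> nat" where
  "total_degree m = (\<Sum>i \<in> Poly_Mapping.keys m. Poly_Mapping.lookup m i)"

lemma total_degree_superset:
  assumes "finite A" "Poly_Mapping.keys m \<subseteq> A"
  shows "total_degree m = (\<Sum>i \<in> A. Poly_Mapping.lookup m i)"
  unfolding total_degree_def
  by (rule sum.mono_neutral_left) (use assms in \<open>auto simp: in_keys_iff\<close>)

lemma forms_iff: "F \<in> forms n d \<longleftrightarrow> F \<in> pring (Suc n) \<and> (\<forall>m \<in> Poly_Mapping.keys F. total_degree m = d)"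
  by (auto simp: forms_def pring_def total_degree_def lessThan_Suc_atMost)

lemma forms_in_pring: "F \<in> forms n d \<Longrightarrow> F \<in> pring (Suc n)"
  by (simp add: forms_iff)

lemma forms_degree_unique: "F \<in> forms n d \<Longrightarrow> F \<in> forms n e \<Longrightarrow> F \<noteq> 0 \<Longrightarrow> d = e"
  unfolding forms_iff by (metis equals0I keys_eq_empty)

lemma forms_zero: "0 \<in> forms n d"
  by (simp add: forms_def)

lemma forms_add: "F \<in> forms n d \<Longrightarrow> G \<in> forms n d \<Longrightarrow> F + G \<in> forms n d"
  using keys_add[of F G] by (fastforce simp: forms_def)

lemma forms_sum: "(\<And>a. a \<in> A \<Longrightarrow> f a \<in> forms n d) \<Longrightarrow> sum f A \<in> forms n d"
  by (induction A rule: infinite_finite_induct) (auto intro: forms_zero forms_add)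

lemma forms_single:
  "Poly_Mapping.keys m \<subseteq> {..n} \<Longrightarrow> total_degree m = d \<Longrightarrow> Poly_Mapping.single m c \<in> forms n d"
  by (auto simp: forms_def total_degree_def)

lemma forms_0_Const:
  assumes "F \<in> forms n 0"
  shows "\<exists>c. F = Const c"
proof -
  have "m = 0" if "m \<in> Poly_Mapping.keys F" for m
  proof -
    have "Poly_Mapping.lookup m i = 0" for i
      using assms that by (cases "i \<in> Poly_Mapping.keys m") (auto simp: forms_def in_keys_iff)
    then show ?thesis
      by (intro poly_mapping_eqI) simp
  qed
  then have "F \<in> pring 0"
    by (auto simp: pring_def)
  then show ?thesis
    by (simp add: pring_0)
qed

text \<open>
  The substitution \<open>x\<^sub>i \<mapsto> x\<^sub>i T\<close>, which makes the homogeneous component of degree \<open>j\<close> of a polynomial the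
  coefficient of \<open>T\<^sup>j\<close>.
\<close>

definition grading :: "cpoly \<Rightarrow> cpoly poly" where
  "grading = mp_eval (\<lambda>c. [:Const c:]) (\<lambda>i. monom (Var i) 1)"

lemma hom_grading: "unital_hom grading"
  unfolding grading_def by (intro hom_mp_eval hom_comp[OF hom_pCons_0 hom_Const])

lemma grading_eq:
  "grading F = (\<Sum>m \<in> Poly_Mapping.keys F.
    monom (Poly_Mapping.single m (Poly_Mapping.lookup F m)) (total_degree m))"
proof -
  have prod: "(\<Prod>i \<in> A. monom (f i) (g i)) = monom (prod f A) (sum g A)"
    for A :: "nat set" and f :: "nat \<Rightarrow> cpoly" and g
    by (induction A rule: infinite_finite_induct) (auto simp: mult_monom)
  have "eval_monomial (\<lambda>i. monom (Var i) 1) m = monom (eval_monomial Var m) (total_degree m)" for m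
    by (simp add: eval_monomial_def monom_power prod total_degree_def)
  then show ?thesis
    by (simp add: grading_def mp_eval_def single_eq_Const_mult smult_monom flip: eval_monomial_def)
qed

lemma coeff_grading_in_forms:
  assumes "F \<in> pring (Suc n)"
  shows "coeff (grading F) j \<in> forms n j"
proof -
  have "coeff (monom (Poly_Mapping.single m (Poly_Mapping.lookup F m)) (total_degree m)) j \<in> forms n j"
    if "m \<in> Poly_Mapping.keys F" for m
    using that assms by (auto simp: pring_def lessThan_Suc_atMost intro: forms_single forms_zero)
  then show ?thesis
    unfolding grading_eq coeff_sum by (intro forms_sum) auto
qed

lemma grading_form:
  assumes "F \<in> forms n d"
  shows "grading F = monom F d"
proof -
  have "grading F = (\<Sum>m \<in> Poly_Mapping.keys F. monom (Poly_Mapping.single m (Poly_Mapping.lookup F m)) d)"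
    unfolding grading_eq using assms by (intro sum.cong) (auto simp: forms_iff)
  also have "\<dots> = monom (\<Sum>m \<in> Poly_Mapping.keys F. Poly_Mapping.single m (Poly_Mapping.lookup F m)) d"
    by (rule poly_eqI) (simp add: coeff_sum)
  finally show ?thesis
    by (simp only: poly_mapping_sum_single)
qed

lemma poly_grading_1: "poly (grading F) 1 = F"
proof -
  have "poly (grading F) 1 = (\<Sum>m \<in> Poly_Mapping.keys F. Poly_Mapping.single m (Poly_Mapping.lookup F m))"
    unfolding grading_eq by (simp add: poly_sum poly_monom)
  then show ?thesis
    by (simp only: poly_mapping_sum_single)
qed

text \<open>
  A monomial is a polynomial whose reversal is constant, and reversal is multiplicative.
\<close>

lemma monom_factor:
  fixes p q :: "'a::idom poly"
  assumes "p * q = monom c d" "c \<noteq> 0"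
  shows "p = monom (lead_coeff p) (degree p)"
proof -
  have "reflect_poly (monom c d) = [:c:]"
    by (rule poly_eqI)
      (use assms(2) in \<open>auto simp: coeff_reflect_poly degree_monom_eq coeff_pCons split: nat.splits\<close>)
  then have "reflect_poly p * reflect_poly q = [:c:]"
    by (simp add: assms(1) flip: reflect_poly_mult)
  then have "degree (reflect_poly p) + degree (reflect_poly q) = 0"
    using assms(2) by (metis degree_mult_eq degree_pCons_0 mult_eq_0_iff pCons_eq_0_iff)
  then have *: "degree (reflect_poly p) = 0"
    by simp
  show ?thesis
  proof (rule poly_eqI)
    fix i
    show "coeff p i = coeff (monom (lead_coeff p) (degree p)) i"
    proof (cases "i < degree p")
      case True
      then have "coeff p i = coeff (reflect_poly p) (degree p - i)"
        by (simp add: coeff_reflect_poly)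
      also have "\<dots> = 0"
        using True * by (intro coeff_eq_0) simp
      finally show ?thesis
        using True by simp
    qed (auto simp: coeff_eq_0)
  qed
qed

text \<open>
  Under the grading a form becomes a monomial in \<open>T\<close>, and a factor of a monomial is a monomial.
\<close>

lemma factor_of_form:
  assumes F: "G * H \<in> forms n d" "G * H \<noteq> 0" and G: "G \<in> pring (Suc n)"
  shows "\<exists>e. G \<in> forms n e"
proof -
  have "grading G * grading H = monom (G * H) d"
    using grading_form[OF F(1)] by (simp add: hom_mult[OF hom_grading])
  then have "grading G = monom (lead_coeff (grading G)) (degree (grading G))"
    using F(2) by (rule monom_factor)
  then have "poly (grading G) 1 = lead_coeff (grading G)"
    by (metis mult_1_right poly_monom power_one)
  then have "G = lead_coeff (grading G)"
    by (simp add: poly_grading_1)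
  then show ?thesis
    using coeff_grading_in_forms[OF G] by metis
qed

lemma factors_of_form:
  assumes F: "G * H \<in> forms n d" "G * H \<noteq> 0" and "G \<in> pring (Suc n)" "H \<in> pring (Suc n)"
  shows "\<exists>a b. G \<in> forms n a \<and> H \<in> forms n b \<and> a + b = d"
proof -
  obtain a b where "G \<in> forms n a" "H \<in> forms n b"
    using factor_of_form[of G H] factor_of_form[of H G] assms by (metis mult.commute)
  then show ?thesis
    using forms_mult forms_degree_unique F by blast
qed

lemma mp_eval_cong:
  assumes "F \<in> pring k" "\<And>i. i < k \<Longrightarrow> x i = y i"
  shows "mp_eval \<phi> x F = mp_eval \<phi> y F"
proof -
  have "x i = y i" if "m \<in> Poly_Mapping.keys F" "i \<in> Poly_Mapping.keys m" for m i
    using assms that by (auto simp: pring_def)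
  then show ?thesis
    unfolding mp_eval_def by (simp cong: sum.cong prod.cong)
qed

definition point :: "nat \<Rightarrow> (nat \<Rightarrow> complex) \<Rightarrow> cvec" where
  "point n y = Abs_poly_mapping (\<lambda>i. if i \<le> n then y i else 0)"

lemma lookup_point: "Poly_Mapping.lookup (point n y) i = (if i \<le> n then y i else 0)"
proof -
  have "finite {i. (if i \<le> n then y i else 0) \<noteq> 0}"
    by (rule finite_subset[of _ "{..n}"]) auto
  then show ?thesis
    by (simp add: point_def)
qed

lemma point_in_vecs: "point n y \<in> vecs n"
  by (auto simp: vecs_def in_keys_iff lookup_point split: if_splits)

lemma val_point: "F \<in> pring (Suc n) \<Longrightarrow> val F (point n y) = mp_eval (\<lambda>c. c) y F"
  unfolding val_def by (rule mp_eval_cong) (auto simp: lookup_point)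

lemma hom_val: "unital_hom (\<lambda>F. val F x)"
  unfolding val_def by (rule hom_mp_eval[OF hom_id])

lemma val_Var: "val (Var i) x = Poly_Mapping.lookup x i"
  by (simp add: val_def mp_eval_Var[OF hom_id])

lemma val_Const: "val (Const c) x = c"
  by (simp add: val_def mp_eval_Const[OF hom_id])

text \<open>
  The condition on the first coordinate comes from applying the separation of polynomials by points to
  \<open>x\<^sub>0 F\<close>. It also rules out the origin.
\<close>

lemma nonvanishing_point:
  assumes "F \<in> pring (Suc n)" "F \<noteq> 0"
  shows "\<exists>x \<in> vecs n. Poly_Mapping.lookup x 0 \<noteq> 0 \<and> val F x \<noteq> 0"
proof -
  interpret nullstellensatz_ring "pring (Suc n)" point_evals
    by (rule nullstellensatz_ring_pring)
  have X: "Var 0 * F \<in> pring (Suc n)"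
    by (intro subring_mult[OF subring] Var_in_pring assms) simp
  moreover have "Var 0 \<noteq> 0"
    using val_Var[of 0 "point 0 (\<lambda>_. 1)"] by (auto simp: lookup_point val_zero)
  ultimately obtain y where "mp_eval (\<lambda>c. c) y (Var 0 * F) \<noteq> 0"
    using separating[OF X] assms(2) by (auto simp: point_evals_def)
  then have "val (Var 0 * F) (point n y) \<noteq> 0"
    by (simp add: val_point[OF X])
  then show ?thesis
    using point_in_vecs by (auto simp: val_mult val_Var)
qed


section \<open>Restriction to lines\<close>

lemma hom_line_restrict: "unital_hom (\<lambda>F. line_restrict F u v)"
  unfolding line_restrict_def by (rule hom_mp_eval[OF hom_pCons_0])

lemma hom_poly: "unital_hom (\<lambda>p. poly p t)"
  by (simp add: unital_hom_def)

lemma poly_line_restrict: "poly (line_restrict F u v) t = val F (u + scale t v)"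
proof -
  have "(\<lambda>i. poly [:Poly_Mapping.lookup u i, Poly_Mapping.lookup v i:] t) =
      Poly_Mapping.lookup (u + scale t v)"
    by (simp add: fun_eq_iff lookup_add lookup_scale)
  then show ?thesis
    unfolding line_restrict_def val_def hom_mp_eval_comp[OF hom_poly hom_pCons_0] by simp
qed

lemma keys_exponent_diff: "Poly_Mapping.keys (m - m') \<subseteq> Poly_Mapping.keys (m :: nat \<Rightarrow>\<^sub>0 nat)"
  by (auto simp: in_keys_iff lookup_minus)

lemma pderiv_sum: "pderiv (sum f A) = (\<Sum>a \<in> A. pderiv (f a))"
  by (induction A rule: infinite_finite_induct) (auto simp: pderiv_add)

lemma pderiv_eval_monomial:
  fixes x :: "nat \<Rightarrow> complex poly"
  assumes "Poly_Mapping.keys m \<subseteq> {..<k}"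
  shows "pderiv (eval_monomial x m) = (\<Sum>i<k. of_nat (Poly_Mapping.lookup m i) *
    eval_monomial x (m - Poly_Mapping.single i 1) * pderiv (x i))"
proof -
  let ?e = "\<lambda>m. Poly_Mapping.lookup m"
  have "of_nat (?e m i) * eval_monomial x (m - Poly_Mapping.single i 1) * pderiv (x i) =
      (\<Prod>j \<in> {..<k} - {i}. x j ^ ?e m j) * pderiv (x i ^ ?e m i)" if i: "i < k" for i
  proof -
    have "Poly_Mapping.keys (m - Poly_Mapping.single i 1) \<subseteq> {..<k}"
      using assms keys_exponent_diff by blast
    then have "eval_monomial x (m - Poly_Mapping.single i 1) =
        (\<Prod>j<k. x j ^ ?e (m - Poly_Mapping.single i 1) j)"
      by (intro eval_monomial_superset) auto
    also have "\<dots> = x i ^ (?e m i - 1) * (\<Prod>j \<in> {..<k} - {i}. x j ^ ?e (m - Poly_Mapping.single i 1) j)"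
      using i by (subst prod.remove[of _ i]) (auto simp: lookup_minus lookup_single)
    also have "(\<Prod>j \<in> {..<k} - {i}. x j ^ ?e (m - Poly_Mapping.single i 1) j) =
        (\<Prod>j \<in> {..<k} - {i}. x j ^ ?e m j)"
      by (intro prod.cong) (auto simp: lookup_minus lookup_single when_def)
    finally show ?thesis
      by (simp add: pderiv_power of_nat_poly algebra_simps)
  qed
  then show ?thesis
    unfolding eval_monomial_superset[OF finite_lessThan assms] pderiv_prod by simp
qed

text \<open>
  The chain rule, linking the formal partial derivatives of \<open>F\<close> to the derivative of its restriction to a line.
\<close>

lemma pderiv_mp_eval:
  assumes "F \<in> pring k"
  shows "pderiv (mp_eval (\<lambda>c. [:c:]) x F) =
    (\<Sum>i<k. mp_eval (\<lambda>c. [:c:]) x (mp_deriv i F) * pderiv (x i))"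
proof -
  let ?c = "Poly_Mapping.lookup F" and ?e = "Poly_Mapping.lookup :: (nat \<Rightarrow>\<^sub>0 nat) \<Rightarrow> nat \<Rightarrow> nat"
  have "pderiv (mp_eval (\<lambda>c. [:c:]) x F) = (\<Sum>m \<in> Poly_Mapping.keys F. [:?c m:] * pderiv (eval_monomial x m))"
    by (simp add: mp_eval_def pderiv_sum pderiv_smult flip: eval_monomial_def)
  also have "\<dots> = (\<Sum>m \<in> Poly_Mapping.keys F. \<Sum>i<k. [:of_nat (?e m i) * ?c m:] *
      eval_monomial x (m - Poly_Mapping.single i 1) * pderiv (x i))"
    using assms by (intro sum.cong refl)
      (auto simp: pderiv_eval_monomial[of _ k] pring_def sum_distrib_left of_nat_poly mult.commute
        intro!: sum.cong)
  also have "\<dots> = (\<Sum>i<k. \<Sum>m \<in> Poly_Mapping.keys F. [:of_nat (?e m i) * ?c m:] *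
      eval_monomial x (m - Poly_Mapping.single i 1) * pderiv (x i))"
    by (rule sum.swap)
  also have "\<dots> = (\<Sum>i<k. mp_eval (\<lambda>c. [:c:]) x (mp_deriv i F) * pderiv (x i))"
    by (simp add: mp_deriv_def mp_eval_sum[OF hom_pCons_0] mp_eval_single[OF hom_pCons_0] sum_distrib_right)
  finally show ?thesis .
qed

definition dir_deriv :: "nat \<Rightarrow> cpoly \<Rightarrow> cvec \<Rightarrow> cvec \<Rightarrow> complex" where
  "dir_deriv n F v u = (\<Sum>i\<le>n. Poly_Mapping.lookup v i * val (mp_deriv i F) u)"

lemma poly_pderiv_line_restrict:
  assumes "F \<in> pring (Suc n)"
  shows "poly (pderiv (line_restrict F u v)) t = dir_deriv n F v (u + scale t v)"
proof -
  have "poly (pderiv (line_restrict F u v)) t =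
      (\<Sum>i<Suc n. poly (line_restrict (mp_deriv i F) u v) t * Poly_Mapping.lookup v i)"
    unfolding line_restrict_def pderiv_mp_eval[OF assms]
    by (simp add: poly_sum pderiv_pCons mult.commute)
  then show ?thesis
    by (simp add: poly_line_restrict dir_deriv_def mult.commute lessThan_Suc_atMost)
qed

lemma scale_0 [simp]: "scale 0 v = 0"
  by (rule poly_mapping_eqI) (simp add: lookup_scale)

lemma scale_1 [simp]: "scale 1 v = v"
  by (rule poly_mapping_eqI) (simp add: lookup_scale)

lemma scale_zero [simp]: "scale c 0 = 0"
  by (rule poly_mapping_eqI) (simp add: lookup_scale)

lemma scale_scale [simp]: "scale a (scale b v) = scale (a * b) v"
  by (rule poly_mapping_eqI) (simp add: lookup_scale)

lemma scale_add_left: "scale (a + b) v = scale a v + scale b v"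
  by (rule poly_mapping_eqI) (simp add: lookup_scale lookup_add algebra_simps)

lemma scale_add_right: "scale a (v + w) = scale a v + scale a w"
  by (rule poly_mapping_eqI) (simp add: lookup_scale lookup_add algebra_simps)

lemma scale_eq_0_iff [simp]: "scale c v = 0 \<longleftrightarrow> c = 0 \<or> v = 0"
proof
  assume "scale c v = 0"
  then have "c * Poly_Mapping.lookup v k = 0" for k
    by (metis lookup_scale lookup_zero)
  then show "c = 0 \<or> v = 0"
    by (cases "c = 0") (auto intro: poly_mapping_eqI)
qed auto

lemma scale_in_vecs: "v \<in> vecs n \<Longrightarrow> scale c v \<in> vecs n"
  by (auto simp: vecs_def in_keys_iff lookup_scale)

lemma add_in_vecs: "u \<in> vecs n \<Longrightarrow> v \<in> vecs n \<Longrightarrow> u + v \<in> vecs n"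
  using keys_add[of u v] by (auto simp: vecs_def)

text \<open>
  The restriction to the degenerate line through \<open>u\<close> and \<open>u\<close> is \<open>(1 + t)\<^sup>d F(u)\<close>.
\<close>

lemma euler:
  assumes "F \<in> forms n d"
  shows "dir_deriv n F u u = of_nat d * val F u"
proof -
  have "line_restrict F u u = smult (val F u) ([:1, 1:] ^ d)"
  proof (rule iffD1[OF poly_eq_poly_eq_iff], rule ext)
    fix t
    have "poly (line_restrict F u u) t = val F (scale (1 + t) u)"
      by (simp add: poly_line_restrict scale_add_left)
    then show "poly (line_restrict F u u) t = poly (smult (val F u) ([:1, 1:] ^ d)) t"
      by (simp add: val_scale[OF assms] mult.commute)
  qed
  then have "poly (pderiv (line_restrict F u u)) 0 = of_nat d * val F u"
    by (simp add: pderiv_smult pderiv_power pderiv_pCons)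
  then show ?thesis
    by (simp add: poly_pderiv_line_restrict[OF forms_in_pring[OF assms]])
qed

lemma mp_deriv_in_forms:
  assumes "F \<in> forms n d"
  shows "mp_deriv i F \<in> forms n (d - 1)"
  unfolding mp_deriv_def
proof (rule forms_sum)
  fix m assume m: "m \<in> Poly_Mapping.keys F"
  show "Poly_Mapping.single (m - Poly_Mapping.single i 1)
      (of_nat (Poly_Mapping.lookup m i) * Poly_Mapping.lookup F m) \<in> forms n (d - 1)"
  proof (cases "Poly_Mapping.lookup m i = 0")
    case False
    have keys: "Poly_Mapping.keys m \<subseteq> {..n}" and deg: "total_degree m = d"
      using m assms by (auto simp: forms_iff pring_def lessThan_Suc_atMost)
    have sub: "Poly_Mapping.keys (m - Poly_Mapping.single i 1) \<subseteq> {..n}"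
      using keys keys_exponent_diff by blast
    have i: "i \<le> n"
      using False keys by (auto simp: in_keys_iff subset_iff)
    have "total_degree m = Poly_Mapping.lookup m i + (\<Sum>j \<in> {..n} - {i}. Poly_Mapping.lookup m j)"
      using i by (simp add: total_degree_superset[OF _ keys] sum.remove[of _ i])
    moreover have "total_degree (m - Poly_Mapping.single i 1) =
        (Poly_Mapping.lookup m i - 1) + (\<Sum>j \<in> {..n} - {i}. Poly_Mapping.lookup (m - Poly_Mapping.single i 1) j)"
      using i by (subst total_degree_superset[OF _ sub]) (simp_all add: sum.remove[of _ i] lookup_minus)
    moreover have "(\<Sum>j \<in> {..n} - {i}. Poly_Mapping.lookup (m - Poly_Mapping.single i 1) j) =
        (\<Sum>j \<in> {..n} - {i}. Poly_Mapping.lookup m j)"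
      by (intro sum.cong) (auto simp: lookup_minus lookup_single when_def)
    ultimately have "total_degree (m - Poly_Mapping.single i 1) = d - 1"
      using deg False by simp
    then show ?thesis
      by (rule forms_single[OF sub])
  qed (simp add: forms_zero)
qed

text \<open>
  Exchanging the two points replaces \<open>P(t)\<close> by \<open>t\<^sup>d P(1/t)\<close>. For constant \<open>P\<close> this is a monomial, whose
  value at \<open>t = 0\<close> is the value of \<open>F\<close> at the point \<open>v\<close> at infinity of the affine line.
\<close>

lemma line_restrict_reverse:
  assumes F: "F \<in> forms n d" and const: "\<And>t. val F (u + scale t v) = c"
  shows "line_restrict F v u = monom c d"
proof -
  let ?q = "line_restrict F v u"
  have "poly ?q s = poly (monom c d) s" if "s \<noteq> 0" for s
  proof -
    have "v + scale s u = scale s (u + scale (1 / s) v)"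
      using that by (simp add: scale_add_right add.commute)
    then show ?thesis
      using val_scale[OF F] const by (simp add: poly_line_restrict poly_monom mult.commute)
  qed
  then have "UNIV - {0} \<subseteq> {s. poly (?q - monom c d) s = 0}"
    by auto
  moreover have "infinite (UNIV - {0 :: complex})"
    by (intro Diff_infinite_finite infinite_UNIV_char_0) simp
  ultimately have "infinite {s. poly (?q - monom c d) s = 0}"
    by (rule infinite_super)
  then show ?thesis
    using poly_roots_finite[of "?q - monom c d"] by (metis right_minus_eq)
qed

text \<open>
  If \<open>F\<close> has no zero on the affine line, its restriction is constant, and then the point at infinity is a zero
  because the degree is positive.
\<close>

lemma form_zero_on_span:
  assumes F: "F \<in> forms n d" and d: "d > 0"
  shows "\<exists>s t. (s, t) \<noteq> (0, 0) \<and> val F (scale s u + scale t v) = 0"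
proof (cases "\<exists>t. val F (u + scale t v) = 0")
  case True
  then obtain t where "val F (scale 1 u + scale t v) = 0"
    by auto
  then show ?thesis
    by (intro exI[of _ 1] exI[of _ t]) simp
next
  case False
  then have "\<nexists>t. poly (line_restrict F u v) t = 0"
    by (simp add: poly_line_restrict)
  then have "constant (poly (line_restrict F u v))"
    using fundamental_theorem_of_algebra by blast
  then have "val F (u + scale t v) = val F u" for t
    using poly_line_restrict[of F u v t] poly_line_restrict[of F u v 0]
    by (simp add: constant_def) metis
  then have "line_restrict F v u = monom (val F u) d"
    by (rule line_restrict_reverse[OF F])
  then have "val F v = 0"
    using d poly_line_restrict[of F v u 0] by (simp add: poly_monom power_0_left)
  then show ?thesis
    by (intro exI[of _ 0] exI[of _ 1]) simp
qed


section \<open>Points, lines and closed sets\<close>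

lemma mem_proj_class: "x \<in> proj_class v \<longleftrightarrow> (\<exists>c. c \<noteq> 0 \<and> x = scale c v)"
  by (auto simp: proj_class_def)

lemma proj_class_eq_iff: "proj_class u = proj_class v \<longleftrightarrow> (\<exists>c. c \<noteq> 0 \<and> u = scale c v)"
proof
  assume "proj_class u = proj_class v"
  moreover have "u \<in> proj_class u"
    unfolding mem_proj_class by (intro exI[of _ 1]) simp
  ultimately show "\<exists>c. c \<noteq> 0 \<and> u = scale c v"
    by (simp add: mem_proj_class)
next
  assume "\<exists>c. c \<noteq> 0 \<and> u = scale c v"
  then obtain c where c: "c \<noteq> 0" "u = scale c v"
    by blast
  show "proj_class u = proj_class v"
  proof (intro equalityI subsetI)
    fix x assume "x \<in> proj_class u"
    then obtain b where "b \<noteq> 0" "x = scale (b * c) v"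
      using c by (auto simp: mem_proj_class)
    then show "x \<in> proj_class v"
      using c unfolding mem_proj_class by (intro exI[of _ "b * c"]) simp
  next
    fix x assume "x \<in> proj_class v"
    then obtain b where "b \<noteq> 0" "x = scale b v"
      by (auto simp: mem_proj_class)
    then have "x = scale (b / c) u"
      using c by simp
    then show "x \<in> proj_class u"
      using c \<open>b \<noteq> 0\<close> unfolding mem_proj_class by (intro exI[of _ "b / c"]) simp
  qed
qed

lemma proj_space_iff: "p \<in> proj_space n \<longleftrightarrow> (\<exists>v \<in> vecs n. v \<noteq> 0 \<and> p = proj_class v)"
  by (auto simp: proj_space_def projectivization_def)

lemma proj_class_in_projectivization:
  assumes "\<And>c v. v \<in> V \<Longrightarrow> scale c v \<in> V"
  shows "proj_class v \<in> projectivization V \<longleftrightarrow> v \<in> V \<and> v \<noteq> 0"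
proof
  assume "proj_class v \<in> projectivization V"
  then show "v \<in> V \<and> v \<noteq> 0"
    using assms by (auto simp: projectivization_def proj_class_eq_iff)
qed (auto simp: projectivization_def)

lemma proj_class_in_proj_space: "proj_class v \<in> proj_space n \<longleftrightarrow> v \<in> vecs n \<and> v \<noteq> 0"
  unfolding proj_space_def by (rule proj_class_in_projectivization) (rule scale_in_vecs)

lemma proj_class_in_line:
  "proj_class w \<in> line_through u v \<longleftrightarrow> w \<noteq> 0 \<and> (\<exists>s t. w = scale s u + scale t v)"
proof -
  have "scale c x \<in> {scale s u + scale t v | s t. True}"
    if x: "x \<in> {scale s u + scale t v | s t. True}" for c x
  proof -
    obtain s t where "x = scale s u + scale t v"
      using x by blast
    then have "scale c x = scale (c * s) u + scale (c * t) v"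
      by (simp add: scale_add_right)
    then show ?thesis
      by blast
  qed
  then show ?thesis
    unfolding line_through_def by (subst proj_class_in_projectivization) auto
qed

lemma proj_class_in_zeros:
  assumes "S \<subseteq> (\<Union>e. forms n e)" "v \<in> vecs n" "v \<noteq> 0"
  shows "proj_class v \<in> proj_zeros n S \<longleftrightarrow> (\<forall>f \<in> S. val f v = 0)"
proof -
  have v: "proj_class v \<in> proj_space n" "v \<in> proj_class v"
    using assms by (auto simp: proj_class_in_proj_space mem_proj_class intro: exI[of _ 1])
  have "val f x = 0 \<longleftrightarrow> val f v = 0" if "f \<in> S" "x \<in> proj_class v" for f x
    using val_proj_class[OF _ v(1) that(2) v(2)] assms(1) that(1) by blast
  then show ?thesis
    unfolding proj_zeros_def using v by blast
qed

lemma proj_zeros_subset: "proj_zeros n S \<subseteq> proj_space n"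
  by (auto simp: proj_zeros_def)

definition vanishes_on :: "nat \<Rightarrow> cpoly \<Rightarrow> cvec set set \<Rightarrow> bool" where
  "vanishes_on n f Z \<longleftrightarrow> (\<forall>x \<in> vecs n. x \<noteq> 0 \<longrightarrow> proj_class x \<in> Z \<longrightarrow> val f x = 0)"

lemma subset_proj_zeros_iff:
  assumes "f \<in> forms n k" "Z \<subseteq> proj_space n"
  shows "Z \<subseteq> proj_zeros n {f} \<longleftrightarrow> vanishes_on n f Z"
proof -
  have f: "{f} \<subseteq> (\<Union>e. forms n e)"
    using assms by blast
  show ?thesis
  proof
    assume "Z \<subseteq> proj_zeros n {f}"
    then show "vanishes_on n f Z"
      unfolding vanishes_on_def using proj_class_in_zeros[OF f] by blast
  next
    assume *: "vanishes_on n f Z"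
    show "Z \<subseteq> proj_zeros n {f}"
    proof
      fix p assume p: "p \<in> Z"
      then obtain x where "x \<in> vecs n" "x \<noteq> 0" "p = proj_class x"
        using assms(2) proj_space_iff by blast
      then show "p \<in> proj_zeros n {f}"
        using * p by (simp add: proj_class_in_zeros[OF f] vanishes_on_def)
    qed
  qed
qed

lemma closedin_proj_zeros: "f \<in> forms n k \<Longrightarrow> closedin (zariski n) (proj_zeros n {f})"
  unfolding closedin_zariski by (intro exI[of _ "{f}"]) auto

lemma closedin_zariski_subset: "closedin (zariski n) Z \<Longrightarrow> Z \<subseteq> proj_space n"
  using closedin_subset topspace_zariski by metis

lemma closed_separation:
  assumes "closedin (zariski n) Z" "p \<in> proj_space n" "p \<notin> Z"
  shows "\<exists>f k. f \<in> forms n k \<and> vanishes_on n f Z \<and> p \<notin> proj_zeros n {f}"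
proof -
  obtain S where S: "S \<subseteq> (\<Union>e. forms n e)" "Z = proj_zeros n S"
    using assms(1) closedin_zariski by blast
  then obtain f where f: "f \<in> S" "p \<notin> proj_zeros n {f}"
    using assms(2,3) by (auto simp: proj_zeros_def)
  moreover obtain k where "f \<in> forms n k"
    using f S by blast
  moreover have "Z \<subseteq> proj_zeros n {f}"
    using S f by (auto simp: proj_zeros_def)
  ultimately show ?thesis
    using subset_proj_zeros_iff S(2) proj_zeros_subset by metis
qed

text \<open>
  A closed set is irreducible iff its homogeneous ideal is proper and prime. This turns covers by closed sets into products of forms.
\<close>

lemma irreducible_closedin_iff:
  "irreducible_closedin (zariski n) Z \<longleftrightarrow> closedin (zariski n) Z \<and> Z \<noteq> {} \<and>
    (\<forall>a b j k. a \<in> forms n j \<longrightarrow> b \<in> forms n k \<longrightarrow> vanishes_on n (a * b) Z \<longrightarrow>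
      vanishes_on n a Z \<or> vanishes_on n b Z)"
    (is "_ \<longleftrightarrow> _ \<and> _ \<and> ?prime")
proof (cases "closedin (zariski n) Z \<and> Z \<noteq> {}")
  case True
  then have Z: "closedin (zariski n) Z" "Z \<noteq> {}" "Z \<subseteq> proj_space n"
    using closedin_zariski_subset by auto
  have "?prime" if irr: "irreducible_closedin (zariski n) Z"
  proof (intro allI impI)
    fix a b j k assume ab: "a \<in> forms n j" "b \<in> forms n k" "vanishes_on n (a * b) Z"
    let ?A = "Z \<inter> proj_zeros n {a}" and ?B = "Z \<inter> proj_zeros n {b}"
    have fab: "{a} \<subseteq> (\<Union>e. forms n e)" "{b} \<subseteq> (\<Union>e. forms n e)"
      using ab by auto
    have "Z \<subseteq> ?A \<union> ?B"
    proof
      fix p assume p: "p \<in> Z"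
      then have "p \<in> proj_space n"
        using Z(3) by blast
      then obtain x where "x \<in> vecs n" "x \<noteq> 0" "p = proj_class x"
        unfolding proj_space_iff by blast
      then show "p \<in> ?A \<union> ?B"
        using ab(3) p proj_class_in_zeros[OF fab(1)] proj_class_in_zeros[OF fab(2)]
        by (auto simp: vanishes_on_def val_mult)
    qed
    then have "Z = ?A \<union> ?B"
      by blast
    moreover have "closedin (zariski n) ?A" "closedin (zariski n) ?B"
      using Z ab by (auto intro: closedin_Int closedin_proj_zeros)
    ultimately have "?A = Z \<or> ?B = Z"
      using irr unfolding irreducible_closedin_def by blast
    then have "Z \<subseteq> proj_zeros n {a} \<or> Z \<subseteq> proj_zeros n {b}"
      by blast
    then show "vanishes_on n a Z \<or> vanishes_on n b Z"
      using subset_proj_zeros_iff ab Z(3) by blast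
  qed
  moreover have "irreducible_closedin (zariski n) Z" if prime: ?prime
    unfolding irreducible_closedin_def
  proof (intro conjI allI impI Z)
    fix A B assume AB: "closedin (zariski n) A \<and> closedin (zariski n) B \<and> Z = A \<union> B"
    show "A = Z \<or> B = Z"
    proof (rule ccontr)
      assume "\<not> ?thesis"
      then obtain p q where pq: "p \<in> Z" "p \<notin> A" "q \<in> Z" "q \<notin> B"
        using AB by blast
      obtain a j where a: "a \<in> forms n j" "vanishes_on n a A" "p \<notin> proj_zeros n {a}"
        using closed_separation[of n A p] AB pq Z(3) by blast
      obtain b k where b: "b \<in> forms n k" "vanishes_on n b B" "q \<notin> proj_zeros n {b}"
        using closed_separation[of n B q] AB pq Z(3) by blast
      have "vanishes_on n (a * b) Z"
        using a(2) b(2) AB by (auto simp: vanishes_on_def val_mult)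
      then have "vanishes_on n a Z \<or> vanishes_on n b Z"
        using prime a(1) b(1) by blast
      then show False
        using subset_proj_zeros_iff[OF a(1) Z(3)] subset_proj_zeros_iff[OF b(1) Z(3)] a(3) b(3) pq
        by blast
    qed
  qed
  ultimately show ?thesis
    using True by blast
qed (auto simp: irreducible_closedin_def)

lemma vanishes_on_proj_space:
  assumes "f \<in> forms n k" "vanishes_on n f (proj_space n)"
  shows "f = 0"
proof (rule ccontr)
  assume "f \<noteq> 0"
  then obtain x where "x \<in> vecs n" "Poly_Mapping.lookup x 0 \<noteq> 0" "val f x \<noteq> 0"
    using nonvanishing_point[OF forms_in_pring[OF assms(1)]] by blast
  moreover from this have "x \<noteq> 0"
    by auto
  ultimately show False
    using assms(2) by (auto simp: vanishes_on_def proj_class_in_proj_space)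
qed

lemma proj_space_irreducible: "irreducible_closedin (zariski n) (proj_space n)"
  unfolding irreducible_closedin_iff
proof (intro conjI allI impI)
  show "closedin (zariski n) (proj_space n)"
    by (metis closedin_topspace topspace_zariski)
  have "point n (\<lambda>_. 1) \<noteq> 0"
    by (metis lookup_point lookup_zero zero_le zero_neq_one)
  then have "proj_class (point n (\<lambda>_. 1)) \<in> proj_space n"
    by (simp add: proj_class_in_proj_space point_in_vecs)
  then show "proj_space n \<noteq> {}"
    by blast
  fix a b j k assume ab: "a \<in> forms n j" "b \<in> forms n k" "vanishes_on n (a * b) (proj_space n)"
  then have "a * b = 0"
    using vanishes_on_proj_space forms_mult by blast
  then have "a = 0 \<or> b = 0"
    by simp
  then show "vanishes_on n a (proj_space n) \<or> vanishes_on n b (proj_space n)"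
    by (auto simp: vanishes_on_def val_zero)
qed

lemma span_eq_0:
  assumes "u \<noteq> 0" "v \<noteq> 0" "proj_class u \<noteq> proj_class v" "scale s u + scale t v = 0"
  shows "s = 0 \<and> t = 0"
proof -
  have "s = 0"
  proof (rule ccontr)
    assume s: "s \<noteq> 0"
    have "scale s u = scale (- t) v"
      using assms(4) by (simp add: add_eq_0_iff poly_mapping_eq_iff fun_eq_iff lookup_scale lookup_add)
    then have "scale (1 / s) (scale s u) = scale (1 / s) (scale (- t) v)"
      by simp
    then have u: "u = scale (- t / s) v"
      using s by simp
    then have "- t / s \<noteq> 0"
      using assms(1) by auto
    then show False
      using u assms(3) proj_class_eq_iff by blast
  qed
  then show ?thesis
    using assms(2,4) by simp
qed

lemma hypersurface_meets_line:
  assumes f: "f \<in> forms n k" "k > 0" and uv: "u \<noteq> 0" "v \<noteq> 0" "proj_class u \<noteq> proj_class v"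
  shows "\<exists>s t. scale s u + scale t v \<noteq> 0 \<and> val f (scale s u + scale t v) = 0"
  using form_zero_on_span[OF f, of u v] span_eq_0[OF uv] by (metis prod.inject)

definition basis_point :: "nat \<Rightarrow> cvec" where
  "basis_point i = Poly_Mapping.single i 1"

lemma basis_point: "i \<le> n \<Longrightarrow> basis_point i \<in> vecs n" "basis_point i \<noteq> 0"
  "Poly_Mapping.lookup (basis_point i) j = (if i = j then 1 else 0)"
proof -
  show l: "Poly_Mapping.lookup (basis_point i) j = (if i = j then 1 else 0)" for j
    by (simp add: basis_point_def lookup_single when_def)
  show "i \<le> n \<Longrightarrow> basis_point i \<in> vecs n"
    by (auto simp: vecs_def basis_point_def)
  show "basis_point i \<noteq> 0"
    using l[of i] by auto
qed

lemma basis_points_distinct: "i \<noteq> j \<Longrightarrow> proj_class (basis_point i) \<noteq> proj_class (basis_point j)"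
proof
  assume ij: "i \<noteq> j" "proj_class (basis_point i) = proj_class (basis_point j)"
  then obtain c where "basis_point i = scale c (basis_point j)"
    using proj_class_eq_iff by blast
  then have "Poly_Mapping.lookup (basis_point i) i = c * Poly_Mapping.lookup (basis_point j) i"
    by (simp add: lookup_scale)
  then show False
    using ij(1) by (simp add: basis_point(3))
qed

lemma hypersurface_nonempty:
  assumes "n \<ge> 1" "f \<in> forms n k" "k > 0"
  shows "\<exists>x \<in> vecs n. x \<noteq> 0 \<and> val f x = 0"
  using hypersurface_meets_line[OF assms(2,3) basis_point(2) basis_point(2) basis_points_distinct[of 0 1]]
    assms(1) by (auto intro!: add_in_vecs scale_in_vecs basis_point(1))


section \<open>Irreducible hypersurfaces and codimension one\<close>

lemma irreducible_form_degree:
  assumes "irreducible_in (pring k) f" "f \<in> forms n e"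
  shows "e > 0"
proof (rule ccontr)
  assume "\<not> e > 0"
  then obtain c where c: "f = Const c"
    using assms forms_0_Const by auto
  then have "c \<noteq> 0"
    using assms(1) hom_0[OF hom_Const] by (auto simp: irreducible_in_def)
  then show False
    using unit_in_pring_Const assms(1) c by (auto simp: irreducible_in_def)
qed

text \<open>
  The affine Nullstellensatz applies to the cone over the hypersurface. At its vertex the hypothesis on projective
  points says nothing; there \<open>h\<close> vanishes by homogeneity, or because it is a constant that vanishes at some
  point of the hypersurface, which is nonempty for \<open>n \<ge> 1\<close>.
\<close>

lemma hypersurface_nullstellensatz:
  assumes n: "n \<ge> 1" and f: "irreducible_in (pring (Suc n)) f" "f \<in> forms n e"
    and h: "h \<in> forms n k" "vanishes_on n h (proj_zeros n {f})"
  shows "dvd_in (pring (Suc n)) f h"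
proof -
  interpret nullstellensatz_ring "pring (Suc n)" point_evals
    by (rule nullstellensatz_ring_pring)
  have e: "e > 0"
    using f by (rule irreducible_form_degree)
  have ff: "{f} \<subseteq> (\<Union>e. forms n e)"
    using f by auto
  have van: "val h x = 0" if "x \<in> vecs n" "x \<noteq> 0" "val f x = 0" for x
    using h(2) that proj_class_in_zeros[OF ff that(1,2)] by (simp add: vanishes_on_def)
  have van0: "val h 0 = 0"
  proof (cases "k = 0")
    case True
    then obtain c where "h = Const c"
      using h forms_0_Const by auto
    then show ?thesis
      using van hypersurface_nonempty[OF n f(2) e] by (auto simp: val_Const)
  next
    case False
    then show ?thesis
      using val_scale[OF h(1), of 0 0] by (simp add: power_0_left)
  qed
  show ?thesis
  proof (rule nullstellensatz[OF f(1) forms_in_pring[OF h(1)]])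
    fix e assume "e \<in> point_evals" "e f = 0"
    then obtain y where "e = mp_eval (\<lambda>c. c) y" "val f (point n y) = 0"
      by (auto simp: point_evals_def val_point[OF forms_in_pring[OF f(2)]])
    then show "e h = 0"
      using van[OF point_in_vecs] van0 by (metis val_point[OF forms_in_pring[OF h(1)]])
  qed
qed

lemma dvd_in_vanishes:
  assumes "dvd_in R f h" "f \<in> forms n e"
  shows "vanishes_on n h (proj_zeros n {f})"
proof -
  have "vanishes_on n f (proj_zeros n {f})"
    using subset_proj_zeros_iff[OF assms(2) proj_zeros_subset] by blast
  then show ?thesis
    using assms(1) by (auto simp: dvd_in_def vanishes_on_def val_mult)
qed

lemma irreducible_hypersurface:
  assumes n: "n \<ge> 1" and f: "irreducible_in (pring (Suc n)) f" "f \<in> forms n e"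
  shows "irreducible_closedin (zariski n) (proj_zeros n {f})"
  unfolding irreducible_closedin_iff
proof (intro conjI allI impI)
  interpret nullstellensatz_ring "pring (Suc n)" point_evals
    by (rule nullstellensatz_ring_pring)
  show "closedin (zariski n) (proj_zeros n {f})"
    using f(2) by (rule closedin_proj_zeros)
  obtain x where "x \<in> vecs n" "x \<noteq> 0" "val f x = 0"
    using hypersurface_nonempty[OF n f(2) irreducible_form_degree[OF f]] by blast
  then have "proj_class x \<in> proj_zeros n {f}"
    using f by (subst proj_class_in_zeros) auto
  then show "proj_zeros n {f} \<noteq> {}"
    by blast
  fix a b j k assume ab: "a \<in> forms n j" "b \<in> forms n k" "vanishes_on n (a * b) (proj_zeros n {f})"
  then have "dvd_in (pring (Suc n)) f (a * b)"
    using hypersurface_nullstellensatz[OF n f forms_mult] by blast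
  then have "dvd_in (pring (Suc n)) f a \<or> dvd_in (pring (Suc n)) f b"
    by (rule prime[OF f(1) forms_in_pring[OF ab(1)] forms_in_pring[OF ab(2)]])
  then show "vanishes_on n a (proj_zeros n {f}) \<or> vanishes_on n b (proj_zeros n {f})"
    using dvd_in_vanishes f(2) by blast
qed

text \<open>
  A nonzero form of least degree vanishing on \<open>Z\<close> is irreducible, since one of its factors vanishes on \<open>Z\<close> as well
  and must have the same degree.
\<close>

lemma irreducible_equation:
  assumes Z: "irreducible_closedin (zariski n) Z" "Z \<noteq> proj_space n"
  shows "\<exists>f k. f \<in> forms n k \<and> irreducible_in (pring (Suc n)) f \<and> vanishes_on n f Z"
proof -
  have closed: "closedin (zariski n) Z" and ne: "Z \<noteq> {}" and sub: "Z \<subseteq> proj_space n"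
    using Z closedin_zariski_subset by (auto simp: irreducible_closedin_def)
  define P where "P k \<longleftrightarrow> (\<exists>f \<in> forms n k. f \<noteq> 0 \<and> vanishes_on n f Z)" for k
  obtain p where p: "p \<in> proj_space n" "p \<notin> Z"
    using Z(2) sub by blast
  then obtain f j where "f \<in> forms n j" "vanishes_on n f Z" "p \<notin> proj_zeros n {f}"
    using closed_separation[OF closed] by blast
  moreover from this have "f \<noteq> 0"
    using p by (auto simp: proj_zeros_def val_zero)
  ultimately have Pj: "P j"
    by (auto simp: P_def)
  define k where "k = (LEAST k. P k)"
  have "P k"
    unfolding k_def using Pj by (rule LeastI)
  then obtain f where f: "f \<in> forms n k" "f \<noteq> 0" "vanishes_on n f Z"
    by (auto simp: P_def)
  have min: "k \<le> j" if "a \<in> forms n j" "a \<noteq> 0" "vanishes_on n a Z" for a j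
    unfolding k_def using that by (intro Least_le) (auto simp: P_def)
  have "irreducible_in (pring (Suc n)) f"
    unfolding irreducible_in_def
  proof (intro conjI ballI impI)
    show "f \<in> pring (Suc n)" "f \<noteq> 0"
      using f forms_in_pring by auto
    obtain q where "q \<in> Z" "q \<in> proj_space n"
      using ne sub by blast
    then obtain x where x: "x \<in> vecs n" "x \<noteq> 0" "proj_class x \<in> Z"
      unfolding proj_space_iff by blast
    then have "val f x = 0"
      using f(3) by (simp add: vanishes_on_def)
    then show "\<not> unit_in (pring (Suc n)) f"
      unfolding unit_in_def by (metis hom_1[OF hom_val] val_mult mult_zero_left zero_neq_one)
    fix a b assume ab: "a \<in> pring (Suc n)" "b \<in> pring (Suc n)" "f = a * b"
    then obtain i j where ij: "a \<in> forms n i" "b \<in> forms n j" "i + j = k"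
      using factors_of_form[of a b n k] f by blast
    have nz: "a \<noteq> 0" "b \<noteq> 0"
      using f(2) ab(3) by auto
    have "vanishes_on n a Z \<or> vanishes_on n b Z"
      using Z(1) ij f(3) ab(3) unfolding irreducible_closedin_iff by blast
    then have "j = 0 \<or> i = 0"
      using min[OF ij(1) nz(1)] min[OF ij(2) nz(2)] ij(3) by auto
    moreover have "unit_in (pring (Suc n)) c" if "c \<in> forms n 0" "c \<noteq> 0" for c
      using that forms_0_Const[OF that(1)] unit_in_pring_Const hom_0[OF hom_Const] by metis
    ultimately show "unit_in (pring (Suc n)) a \<or> unit_in (pring (Suc n)) b"
      using ij nz by auto
  qed
  then show ?thesis
    using f by blast
qed

text \<open>
  An irreducible equation \<open>g\<close> of a proper \<open>Y\<close> would be a multiple of \<open>f\<close>, hence associated to \<open>f\<close>, so that \<open>Y\<close>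
  would lie in the hypersurface of \<open>f\<close>.
\<close>

lemma hypersurface_maximal:
  assumes n: "n \<ge> 1" and f: "irreducible_in (pring (Suc n)) f" "f \<in> forms n e"
    and Y: "irreducible_closedin (zariski n) Y" "proj_zeros n {f} \<subset> Y"
  shows "Y = proj_space n"
proof (rule ccontr)
  assume "Y \<noteq> proj_space n"
  then obtain g k where g: "g \<in> forms n k" "irreducible_in (pring (Suc n)) g" "vanishes_on n g Y"
    using irreducible_equation Y(1) by blast
  have sub: "Y \<subseteq> proj_space n"
    using Y closedin_zariski_subset by (auto simp: irreducible_closedin_def)
  have "vanishes_on n g (proj_zeros n {f})"
    using g(3) Y(2) by (auto simp: vanishes_on_def)
  then have "dvd_in (pring (Suc n)) f g"
    by (rule hypersurface_nullstellensatz[OF n f g(1)])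
  then obtain h where h: "h \<in> pring (Suc n)" "g = f * h"
    by (auto simp: dvd_in_def)
  then have "unit_in (pring (Suc n)) h"
    using f(1) g(2) unfolding irreducible_in_def by blast
  then have "dvd_in (pring (Suc n)) g f"
    using unit_in_dvd[OF subring_pring _ forms_in_pring[OF g(1)] forms_in_pring[OF f(2)] h(2)] by blast
  then have "vanishes_on n f (proj_zeros n {g})"
    using dvd_in_vanishes g(1) by blast
  moreover have "Y \<subseteq> proj_zeros n {g}"
    using subset_proj_zeros_iff[OF g(1) sub] g(3) by blast
  ultimately have "vanishes_on n f Y"
    by (auto simp: vanishes_on_def)
  then have "Y \<subseteq> proj_zeros n {f}"
    using subset_proj_zeros_iff[OF f(2) sub] by blast
  then show False
    using Y(2) by blast
qed

lemma irred_codim_hypersurface: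
  assumes n: "n \<ge> 1" and f: "irreducible_in (pring (Suc n)) f" "f \<in> forms n e"
  shows "irred_codim (zariski n) (proj_zeros n {f}) \<le> 1"
  unfolding irred_codim_def
proof (rule Sup_least)
  fix x assume "x \<in> {enat k | k. \<exists>Y :: nat \<Rightarrow> cvec set set. Y 0 = proj_zeros n {f} \<and>
     (\<forall>i \<le> k. irreducible_closedin (zariski n) (Y i)) \<and> (\<forall>i < k. Y i \<subset> Y (Suc i))}"
  then obtain k and Y :: "nat \<Rightarrow> cvec set set" where Y: "x = enat k" "Y 0 = proj_zeros n {f}"
    "\<And>i. i \<le> k \<Longrightarrow> irreducible_closedin (zariski n) (Y i)" "\<And>i. i < k \<Longrightarrow> Y i \<subset> Y (Suc i)"
    by blast
  have "k \<le> 1"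
  proof (rule ccontr)
    assume k: "\<not> k \<le> 1"
    then have "Y 1 = proj_space n"
      using hypersurface_maximal[OF n f Y(3)[of 1]] Y(2) Y(4)[of 0] by simp
    moreover have "Y 1 \<subset> Y 2" "Y 2 \<subseteq> proj_space n"
      using k Y(4)[of 1] Y(3)[of 2] closedin_zariski_subset
      by (auto simp: numeral_2_eq_2 irreducible_closedin_def)
    ultimately show False
      by blast
  qed
  then show "x \<le> 1"
    by (simp add: Y(1) one_enat_def)
qed

text \<open>
  With \<open>f\<close> an irreducible equation of \<open>Y\<close>, a strict inclusion of \<open>Y\<close> in the hypersurface of \<open>f\<close> would extend
  to a chain of length two that ends in the whole space.
\<close>

lemma irred_codim_le_1:
  assumes n: "n \<ge> 1" and Y: "irreducible_closedin (zariski n) Y" "irred_codim (zariski n) Y \<le> 1"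
    and proper: "Y \<noteq> proj_space n"
  shows "\<exists>f k. f \<in> forms n k \<and> irreducible_in (pring (Suc n)) f \<and> Y = proj_zeros n {f}"
proof -
  obtain f k where f: "f \<in> forms n k" "irreducible_in (pring (Suc n)) f" "vanishes_on n f Y"
    using irreducible_equation[OF Y(1) proper] by blast
  have sub: "Y \<subseteq> proj_zeros n {f}"
    using subset_proj_zeros_iff f Y(1) closedin_zariski_subset
    by (metis irreducible_closedin_def)
  have "Y = proj_zeros n {f}"
  proof (rule ccontr)
    assume ne: "Y \<noteq> proj_zeros n {f}"
    define C where "C i = (if i = 0 then Y else if i = 1 then proj_zeros n {f} else proj_space n)"
      for i :: nat
    have "proj_zeros n {f} \<noteq> proj_space n"
      using vanishes_on_proj_space[OF f(1)] subset_proj_zeros_iff[OF f(1), of "proj_space n"] f(2)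
      by (auto simp: irreducible_in_def)
    then have "proj_zeros n {f} \<subset> proj_space n"
      using proj_zeros_subset by blast
    then have "\<forall>i < 2. C i \<subset> C (Suc i)"
      using sub ne by (auto simp: C_def less_2_cases_iff)
    moreover have "\<forall>i \<le> 2. irreducible_closedin (zariski n) (C i)"
      using Y(1) irreducible_hypersurface[OF n f(2,1)] proj_space_irreducible by (auto simp: C_def)
    moreover have "C 0 = Y"
      by (simp add: C_def)
    ultimately have "enat 2 \<le> irred_codim (zariski n) Y"
      unfolding irred_codim_def by (intro Sup_upper) blast
    then have "enat 2 \<le> 1"
      using Y(2) by (rule order_trans)
    then show False
      by (simp add: one_enat_def)
  qed
  then show ?thesis
    using f by blast
qed

lemma Inf_enat_attained:
  assumes "Inf A \<le> (1 :: enat)"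
  shows "\<exists>a \<in> A. a \<le> 1"
proof (cases "A = {}")
  case True
  then show ?thesis
    using assms by (simp add: Inf_enat_def)
next
  case False
  then have "Inf A \<in> A"
    unfolding Inf_enat_def using LeastI_ex[of "\<lambda>x. x \<in> A"] by auto
  then show ?thesis
    using assms by blast
qed


section \<open>Tangency and the singular locus\<close>

definition sing_locus :: "nat \<Rightarrow> cpoly \<Rightarrow> cvec set set" where
  "sing_locus n F = proj_zeros n {mp_deriv i F | i. i \<le> n}"

lemma proj_class_in_sing_locus:
  assumes "F \<in> forms n d" "x \<in> vecs n" "x \<noteq> 0"
  shows "proj_class x \<in> sing_locus n F \<longleftrightarrow> (\<forall>i \<le> n. val (mp_deriv i F) x = 0)"
proof -
  have "{mp_deriv i F | i. i \<le> n} \<subseteq> (\<Union>e. forms n e)"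
    using mp_deriv_in_forms[OF assms(1)] by blast
  then show ?thesis
    unfolding sing_locus_def using assms(2,3) by (subst proj_class_in_zeros) auto
qed

lemma order_ge_2_iff:
  fixes p :: "complex poly"
  assumes "p \<noteq> 0"
  shows "order 0 p \<ge> 2 \<longleftrightarrow> poly p 0 = 0 \<and> poly (pderiv p) 0 = 0"
proof -
  have "order 0 p \<ge> 2 \<longleftrightarrow> monom 1 2 dvd p"
    using monom_1_dvd_iff[OF assms] by simp
  also have "\<dots> \<longleftrightarrow> coeff p 0 = 0 \<and> coeff p 1 = 0"
    unfolding monom_1_dvd_iff' by (auto simp: less_2_cases_iff)
  finally show ?thesis
    by (simp add: poly_0_coeff_0 coeff_pderiv)
qed

lemma lines_iff: "l \<in> lines n \<longleftrightarrow> (\<exists>u v. l = line_through u v \<and> u \<in> vecs n \<and> v \<in> vecs n \<and>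
    u \<noteq> 0 \<and> v \<noteq> 0 \<and> proj_class u \<noteq> proj_class v)"
  by (auto simp: lines_def)

lemma line_subset_proj_space:
  assumes "l \<in> lines n"
  shows "l \<subseteq> proj_space n"
proof -
  obtain u v where "l = line_through u v" "u \<in> vecs n" "v \<in> vecs n"
    using assms unfolding lines_iff by blast
  then show ?thesis
    by (auto simp: line_through_def projectivization_def proj_class_in_proj_space
        intro!: add_in_vecs scale_in_vecs)
qed

text \<open>
  By Euler's formula \<open>F\<close> vanishes at a singular point \<open>w\<close>, with all its directional derivatives. To read off the
  multiplicity, the second point \<open>z\<close> on the line is chosen outside the hypersurface, if there is one, which makes the restriction nonzero.
\<close>

lemma singular_point_tangent:
  assumes F: "F \<in> forms n d" "d > 0" and l: "l \<in> lines n"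
    and w: "proj_class w \<in> l" "proj_class w \<in> sing_locus n F"
  shows "tangent_to_line n F l"
proof (cases "l \<subseteq> proj_zeros n {F}")
  case True
  then show ?thesis
    by (simp add: tangent_to_line_def)
next
  case False
  have FF: "{F} \<subseteq> (\<Union>e. forms n e)"
    using F by auto
  have wn: "w \<in> vecs n" "w \<noteq> 0"
    using w(1) line_subset_proj_space[OF l] proj_class_in_proj_space by auto
  have D: "dir_deriv n F z w = 0" for z
    using w(2) by (simp add: proj_class_in_sing_locus[OF F(1) wn] dir_deriv_def)
  then have Fw: "val F w = 0"
    using euler[OF F(1), of w] F(2) by simp
  obtain p where "p \<in> l" "p \<notin> proj_zeros n {F}"
    using False by blast
  moreover obtain z where "z \<in> vecs n" "z \<noteq> 0" "p = proj_class z"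
    using calculation line_subset_proj_space[OF l] proj_space_iff by blast
  ultimately have z: "proj_class z \<in> l" "z \<noteq> 0" "val F z \<noteq> 0"
    using proj_class_in_zeros[OF FF] by auto
  let ?p = "line_restrict F w z"
  have "?p \<noteq> 0"
  proof
    assume "?p = 0"
    then have "val F (w + scale t z) = 0" for t
      by (metis poly_line_restrict poly_0)
    then have "line_restrict F z w = monom 0 d"
      by (rule line_restrict_reverse[OF F(1)])
    then show False
      using z(3) poly_line_restrict[of F z w 0] by simp
  qed
  moreover have "poly ?p 0 = 0" "poly (pderiv ?p) 0 = 0"
    by (simp_all add: poly_line_restrict poly_pderiv_line_restrict[OF forms_in_pring[OF F(1)]] Fw D)
  ultimately have "order 0 ?p \<ge> 2"
    using order_ge_2_iff by blast
  moreover have "proj_class w \<noteq> proj_class z"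
  proof
    assume "proj_class w = proj_class z"
    then obtain c where "z = scale c w"
      using proj_class_eq_iff by metis
    then show False
      using z(3) Fw val_scale[OF F(1)] by simp
  qed
  ultimately show ?thesis
    unfolding tangent_to_line_def using wn w(1) z \<open>?p \<noteq> 0\<close> by blast
qed

lemma tangent_point:
  assumes F: "F \<in> forms n d" and t: "tangent_to_line n F l" and l: "\<not> l \<subseteq> proj_zeros n {F}"
  shows "\<exists>u v. v \<noteq> 0 \<and> proj_class u \<in> l \<and> proj_class v \<in> l \<and> proj_class u \<noteq> proj_class v \<and>
    val F u = 0 \<and> dir_deriv n F v u = 0"
proof -
  obtain u v where uv: "v \<noteq> 0" "proj_class u \<in> l" "proj_class v \<in> l" "proj_class u \<noteq> proj_class v"
    "line_restrict F u v \<noteq> 0" "order 0 (line_restrict F u v) \<ge> 2"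
    using t l unfolding tangent_to_line_def by blast
  then have "poly (line_restrict F u v) 0 = 0" "poly (pderiv (line_restrict F u v)) 0 = 0"
    using order_ge_2_iff by auto
  then have "val F u = 0" "dir_deriv n F v u = 0"
    by (simp_all add: poly_line_restrict poly_pderiv_line_restrict[OF forms_in_pring[OF F]])
  then show ?thesis
    using uv by blast
qed

lemma scale_eq_Const_mult: "scale c F = Const c * F"
  unfolding scale_def Const_def by (rule mult_map_scale_conv_mult)

lemma tangent_to_line_scale:
  assumes "c \<noteq> 0" "F \<in> forms n d" "tangent_to_line n (scale c F) l"
  shows "tangent_to_line n F l"
proof -
  have val: "val (scale c F) x = c * val F x" for x
    by (simp add: scale_eq_Const_mult val_mult val_Const)
  have "line_restrict (Const c) u v = [:c:]" for u v
    by (simp add: line_restrict_def mp_eval_Const[OF hom_pCons_0])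
  then have "line_restrict (scale c F) u v = smult c (line_restrict F u v)" for u v
    by (simp add: scale_eq_Const_mult hom_mult[OF hom_line_restrict])
  moreover have "proj_zeros n {scale c F} = proj_zeros n {F}"
    using assms(1) by (simp add: proj_zeros_def val)
  ultimately show ?thesis
    using assms(1,3) by (auto simp: tangent_to_line_def order_smult)
qed

text \<open>
  The singular locus contains the whole space or a hypersurface, and therefore a point of every line.
\<close>

lemma tangent_if_sgr_le_1:
  assumes n: "n \<ge> 1" and F: "F \<in> forms n d" "d > 0" and sgr: "sgr n F \<le> 1" and l: "l \<in> lines n"
  shows "tangent_to_line n F l"
proof -
  have "sing_locus n F \<noteq> {}"
    using sgr n by (auto simp: sgr_def proj_codim_def sing_locus_def one_enat_def)
  then have "codim (zariski n) (sing_locus n F) \<le> 1"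
    using sgr by (simp add: sgr_def proj_codim_def sing_locus_def)
  then obtain Y where Y: "irreducible_closedin (zariski n) Y" "Y \<subseteq> sing_locus n F"
    "irred_codim (zariski n) Y \<le> 1"
    unfolding codim_def by (auto dest!: Inf_enat_attained)
  obtain u v where uv: "l = line_through u v" "u \<in> vecs n" "v \<in> vecs n" "u \<noteq> 0" "v \<noteq> 0"
    "proj_class u \<noteq> proj_class v"
    using l unfolding lines_iff by blast
  have "\<exists>w. proj_class w \<in> l \<and> proj_class w \<in> Y"
  proof (cases "Y = proj_space n")
    case True
    then have "proj_class u \<in> Y"
      using uv by (simp add: proj_class_in_proj_space)
    moreover have "proj_class u \<in> l"
      unfolding uv(1) proj_class_in_line using uv(4)
      by (intro conjI exI[of _ 1] exI[of _ 0]) simp_all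
    ultimately show ?thesis
      by blast
  next
    case False
    then obtain f k where f: "f \<in> forms n k" "irreducible_in (pring (Suc n)) f" "Y = proj_zeros n {f}"
      using irred_codim_le_1[OF n Y(1,3)] by blast
    obtain s t where st: "scale s u + scale t v \<noteq> 0" "val f (scale s u + scale t v) = 0"
      using hypersurface_meets_line[OF f(1) irreducible_form_degree[OF f(2,1)] uv(4-6)] by blast
    have "proj_class (scale s u + scale t v) \<in> l"
      unfolding uv(1) proj_class_in_line using st by blast
    moreover have "proj_class (scale s u + scale t v) \<in> Y"
      unfolding f(3) using st uv f(1)
      by (subst proj_class_in_zeros) (auto intro!: add_in_vecs scale_in_vecs)
    ultimately show ?thesis
      by blast
  qed
  then show ?thesis
    using singular_point_tangent[OF F l] Y(2) by blast
qed

text \<open>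
  The restriction of \<open>G\<^sup>2 H\<close> to a line through a zero of \<open>G\<close> has a double zero there, in every direction. So the
  hypersurface of \<open>G\<close> consists of singular points.
\<close>

lemma sgr_le_1_if_square_factor:
  assumes n: "n \<ge> 1" and F: "F \<in> forms n d" "F \<noteq> 0"
    and G: "irreducible_in (pring (Suc n)) G" "dvd_in (pring (Suc n)) (G * G) F"
  shows "sgr n F \<le> 1"
proof -
  have GR: "G \<in> pring (Suc n)"
    using G by (simp add: irreducible_in_def)
  obtain H where H: "H \<in> pring (Suc n)" "F = G * (G * H)"
    using G(2) by (auto simp: dvd_in_def mult.assoc)
  then obtain e where e: "G \<in> forms n e"
    using factor_of_form[of G "G * H" n d] F GR by blast
  have "proj_zeros n {G} \<subseteq> sing_locus n F"
  proof
    fix p assume "p \<in> proj_zeros n {G}"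
    moreover from this obtain x where x: "x \<in> vecs n" "x \<noteq> 0" "p = proj_class x"
      using proj_zeros_subset proj_space_iff by blast
    ultimately have Gx: "val G x = 0"
      using proj_class_in_zeros[of "{G}" n x] e by auto
    have "val (mp_deriv i F) x = 0" if i: "i \<le> n" for i
    proof -
      let ?r = "\<lambda>F. line_restrict F x (basis_point i)"
      have "?r F = ?r G * (?r G * ?r H)"
        by (simp add: H(2) hom_mult[OF hom_line_restrict])
      moreover have "poly (?r G) 0 = 0"
        by (simp add: poly_line_restrict Gx)
      ultimately have "poly (pderiv (?r F)) 0 = 0"
        by (simp add: pderiv_mult)
      then show ?thesis
        using i by (simp add: poly_pderiv_line_restrict[OF forms_in_pring[OF F(1)]] dir_deriv_def
            basis_point(3) if_distrib[of "\<lambda>a. a * _"] cong: if_cong)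
    qed
    then show "p \<in> sing_locus n F"
      by (simp add: x(3) proj_class_in_sing_locus[OF F(1) x(1,2)])
  qed
  moreover have irr: "irreducible_closedin (zariski n) (proj_zeros n {G})"
    by (rule irreducible_hypersurface[OF n G(1) e])
  ultimately have "codim (zariski n) (sing_locus n F) \<le> irred_codim (zariski n) (proj_zeros n {G})"
    unfolding codim_def by (intro Inf_lower) blast
  also have "\<dots> \<le> 1"
    by (rule irred_codim_hypersurface[OF n G(1) e])
  finally have "codim (zariski n) (sing_locus n F) \<le> 1" .
  moreover have "sing_locus n F \<noteq> {}"
    using \<open>proj_zeros n {G} \<subseteq> sing_locus n F\<close> irr by (auto simp: irreducible_closedin_def)
  ultimately show ?thesis
    by (simp add: sgr_def proj_codim_def sing_locus_def)
qed

lemma dir_deriv_scale_point: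
  "F \<in> forms n d \<Longrightarrow> dir_deriv n F v (scale c u) = c ^ (d - 1) * dir_deriv n F v u"
  by (simp add: dir_deriv_def val_scale[OF mp_deriv_in_forms] sum_distrib_left algebra_simps)

lemma dir_deriv_combination:
  "dir_deriv n F (scale a u + scale b v) x = a * dir_deriv n F u x + b * dir_deriv n F v x"
  by (simp add: dir_deriv_def lookup_add lookup_scale sum_distrib_left algebra_simps sum.distrib)

text \<open>
  Tangency provides a point \<open>x\<close> on the line where \<open>F\<close> vanishes together with its derivative in one direction \<open>y\<close>
  transversal to \<open>x\<close>. By Euler's formula the derivative in direction \<open>x\<close> vanishes as well, so it vanishes in every
  direction of the span, in particular \<open>p\<close>. As \<open>F(p) \<noteq> 0\<close>, the point \<open>x\<close> differs from \<open>p\<close> and can be scaled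
  to \<open>u + t p\<close>. The case \<open>u = 0\<close>, where there is no line, is covered by \<open>F(t p) = t\<^sup>d F(p)\<close> and \<open>d \<ge> 2\<close>.
\<close>

lemma tangent_to_line_through:
  assumes F: "F \<in> forms n d" "d \<ge> 2" and p: "p \<in> vecs n" "val F p \<noteq> 0"
    and u: "u \<in> vecs n" "u = 0 \<or> proj_class u \<noteq> proj_class p"
    and tangent: "\<And>l. l \<in> lines n \<Longrightarrow> tangent_to_line n F l"
  shows "\<exists>t. val F (u + scale t p) = 0 \<and> dir_deriv n F p (u + scale t p) = 0"
proof (cases "u = 0")
  case True
  have "val F 0 = 0"
    using val_scale[OF F(1), of 0 0] F(2) by (simp add: power_0_left)
  moreover have "dir_deriv n F p 0 = 0"
    using dir_deriv_scale_point[OF F(1), of p 0 0] F(2) by (simp add: power_0_left)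
  ultimately show ?thesis
    using True by (intro exI[of _ 0]) simp
next
  case False
  have p0: "p \<noteq> 0"
    using p(2) val_scale[OF F(1), of 0 0] F(2) by (auto simp: power_0_left)
  let ?l = "line_through u p"
  have l: "?l \<in> lines n"
    unfolding lines_iff using False u p p0 by blast
  have "proj_class p \<in> ?l"
    unfolding proj_class_in_line using p0 by (intro conjI exI[of _ 0] exI[of _ 1]) simp_all
  moreover have "proj_class p \<notin> proj_zeros n {F}"
    using F(1) p p0 by (subst proj_class_in_zeros) auto
  ultimately have "\<not> ?l \<subseteq> proj_zeros n {F}"
    by blast
  then obtain x y where xy: "y \<noteq> 0" "proj_class x \<in> ?l" "proj_class y \<in> ?l"
    "proj_class x \<noteq> proj_class y" "val F x = 0" "dir_deriv n F y x = 0"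
    using tangent_point[OF F(1) tangent[OF l]] by blast
  obtain a b where x: "x = scale a u + scale b p" "x \<noteq> 0"
    using xy(2) proj_class_in_line by blast
  obtain a' b' where y: "y = scale a' u + scale b' p"
    using xy(3) proj_class_in_line by blast
  have a: "a \<noteq> 0"
  proof
    assume a: "a = 0"
    then have "b \<noteq> 0"
      using x by auto
    then show False
      using xy(5) p(2) a val_scale[OF F(1)] by (simp add: x(1))
  qed
  \<comment> \<open>Otherwise \<open>x\<close> and \<open>y\<close> would be proportional.\<close>
  have det: "a' * b - a * b' \<noteq> 0"
  proof
    assume "a' * b - a * b' = 0"
    then have "b' = a' / a * b"
      using a by (simp add: field_simps)
    then have y_eq: "y = scale (a' / a) x"
      using a by (simp add: x(1) y scale_add_right)
    then have "a' / a \<noteq> 0"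
      using xy(1) by auto
    then show False
      using y_eq xy(4) proj_class_eq_iff by metis
  qed
  have "scale a' x + scale (- a) y = scale (a' * b - a * b') p"
    by (rule poly_mapping_eqI) (simp add: x(1) y lookup_add lookup_scale algebra_simps)
  moreover have "dir_deriv n F (scale a' x + scale (- a) y) x = 0"
    using euler[OF F(1), of x] xy(5,6) by (simp add: dir_deriv_combination)
  ultimately have "(a' * b - a * b') * dir_deriv n F p x = 0"
    using dir_deriv_combination[of n F "a' * b - a * b'" p 0 p x] by simp
  then have "dir_deriv n F p x = 0"
    using det by simp
  moreover have "x = scale a (u + scale (b / a) p)"
    using a by (simp add: x(1) scale_add_right)
  ultimately show ?thesis
    using xy(5) a val_scale[OF F(1)] dir_deriv_scale_point[OF F(1)]
    by (intro exI[of _ "b / a"]) simp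
qed

lemma map_poly_pderiv:
  assumes "unital_hom h"
  shows "map_poly h (pderiv p) = pderiv (map_poly h p)"
  by (rule poly_eqI) (simp add: coeff_map_poly hom_0[OF assms] coeff_pderiv hom_mult[OF assms]
      hom_of_nat[OF assms] hom_add[OF assms] hom_1[OF assms])

text \<open>
  In coordinates adapted to a point \<open>p\<close> off the hypersurface, the restrictions of \<open>F\<close> to the lines through \<open>p\<close> are
  the specializations of one polynomial in one variable over \<open>\<complex>[y\<^sub>1, \<dots>, y\<^sub>n]\<close>, and tangency says that each
  of them has a multiple root.
\<close>

lemma square_factor_if_tangent:
  assumes F: "F \<in> forms n d" "F \<noteq> 0" "d \<ge> 2"
    and tangent: "\<And>l. l \<in> lines n \<Longrightarrow> tangent_to_line n F l"
  shows "\<exists>G. irreducible_in (pring (Suc n)) G \<and> dvd_in (pring (Suc n)) (G * G) F"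
proof -
  obtain x where x: "x \<in> vecs n" "Poly_Mapping.lookup x 0 \<noteq> 0" "val F x \<noteq> 0"
    using nonvanishing_point[OF forms_in_pring[OF F(1)] F(2)] by blast
  define p where "p = scale (1 / Poly_Mapping.lookup x 0) x"
  have p: "p \<in> vecs n" "Poly_Mapping.lookup p 0 = 1" "val F p \<noteq> 0"
    using x val_scale[OF F(1)] by (auto simp: p_def lookup_scale intro: scale_in_vecs)
  define q where "q = (\<lambda>j. Poly_Mapping.lookup p (Suc j))"
  interpret R: nullstellensatz_ring "pring n" point_evals
    by (rule nullstellensatz_ring_pring)
  interpret iso: subring_iso "split_var q" "join_var q" "pring (Suc n)" "polys (pring n)"
    by (rule subring_iso_split_var)
  let ?f = "split_var q F"
  have "\<exists>t. poly (map_poly e ?f) t = 0 \<and> poly (map_poly e (pderiv ?f)) t = 0" if e: "e \<in> point_evals" for e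
  proof -
    note he = R.hom[OF e]
    obtain y where y: "e = mp_eval (\<lambda>c. c) y"
      using e by (auto simp: point_evals_def)
    define u where "u = point n (case_nat 0 y)"
    have "poly (map_poly e ?f) t = poly (line_restrict F u p) t" for t
    proof -
      have "poly (map_poly e ?f) t = mp_eval (\<lambda>c. c) (case_nat t (\<lambda>j. y j + t * q j)) F"
        unfolding y by (rule eval_split_var)
      also have "\<dots> = val F (u + scale t p)"
        unfolding val_def
        by (rule mp_eval_cong[OF forms_in_pring[OF F(1)]])
          (auto simp: u_def q_def lookup_add lookup_scale lookup_point p(2) split: nat.splits)
      finally show ?thesis
        by (simp add: poly_line_restrict)
    qed
    then have eq: "map_poly e ?f = line_restrict F u p"
      by (intro iffD1[OF poly_eq_poly_eq_iff] ext)
    have "Poly_Mapping.lookup u 0 = 0"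
      by (simp add: u_def lookup_point)
    then have "proj_class u \<noteq> proj_class p"
      using p(2) by (auto simp: proj_class_eq_iff lookup_scale)
    then obtain t where "val F (u + scale t p) = 0" "dir_deriv n F p (u + scale t p) = 0"
      using tangent_to_line_through[OF F(1,3) p(1,3), of u] tangent
      by (auto simp: u_def point_in_vecs)
    then show ?thesis
      unfolding map_poly_pderiv[OF he] eq
      by (auto simp: poly_line_restrict poly_pderiv_line_restrict[OF forms_in_pring[OF F(1)]])
  qed
  moreover have "of_nat (Suc k) \<noteq> (0 :: cpoly)" for k
    by (rule of_nat_neq_0)
  moreover have "?f \<in> polys (pring n)" "?f \<noteq> 0"
    using F forms_in_pring by (auto simp: iso.in_iff iso.eq_0_iff)
  ultimately obtain g where g: "irreducible_in (polys (pring n)) g" "dvd_in (polys (pring n)) (g * g) ?f"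
    using R.square_factor by metis
  have "g = split_var q (join_var q g)"
    by (simp add: split_join_var)
  then show ?thesis
    using g iso.irreducible_in_iff iso.dvd_in_iff hom_mult[OF hom_split_var] by metis
qed

theorem theorem4p6:
  fixes d n :: nat
  assumes "d \<ge> 3" and "n \<ge> 1"
  shows "(\<Inter>l \<in> lines n. tangent_hypersurfaces n d l) = sgr_locus n d 1"
proof (intro equalityI subsetI)
  fix C assume C: "C \<in> (\<Inter>l \<in> lines n. tangent_hypersurfaces n d l)"
  have "line_through (basis_point 0) (basis_point 1) \<in> lines n"
    unfolding lines_iff using assms(2) basis_point basis_points_distinct[of 0 1] by (metis le0 zero_neq_one)
  then obtain F where F: "C = proj_class F" "F \<in> forms n d" "F \<noteq> 0"
    using C by (auto simp: tangent_hypersurfaces_def)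
  \<comment> \<open>The representative of the class \<open>C\<close> may depend on the line.\<close>
  have "tangent_to_line n F l" if "l \<in> lines n" for l
  proof -
    have "C \<in> tangent_hypersurfaces n d l"
      using C that by blast
    then obtain F' where "C = proj_class F'" "tangent_to_line n F' l"
      by (auto simp: tangent_hypersurfaces_def)
    moreover from this obtain c where "c \<noteq> 0" "F' = scale c F"
      using F(1) proj_class_eq_iff by metis
    ultimately show ?thesis
      using tangent_to_line_scale F(2) by blast
  qed
  then have "sgr n F \<le> 1"
    using square_factor_if_tangent[OF F(2,3)] sgr_le_1_if_square_factor[OF assms(2) F(2,3)] assms(1)
    by auto
  then show "C \<in> sgr_locus n d 1"
    using F by (auto simp: sgr_locus_def one_enat_def)
next
  fix C assume "C \<in> sgr_locus n d 1"
  then obtain F where F: "C = proj_class F" "F \<in> forms n d" "F \<noteq> 0" "sgr n F \<le> 1"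
    by (auto simp: sgr_locus_def one_enat_def)
  then show "C \<in> (\<Inter>l \<in> lines n. tangent_hypersurfaces n d l)"
    using tangent_if_sgr_le_1[OF assms(2) F(2) _ F(4)] assms(1) by (auto simp: tangent_hypersurfaces_def)
qed

end
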